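(* Let $(\mathcal{A}_{i,\ell},\mathcal{A}_{i,r})_{i\in I}$ be a family of pairs of algebras in a noncommutative probability space $(\mathcal{A},\phi)$. The family is free-Boolean independent if and only if the following two conditions hold for all products $Z_k=z_{1,k}\cdots z_{s_k,k}$, $k=1,\dots,m$, such that $s_k>0$, $z_{t,k}\in\mathcal{A}_{j_k,\ell}\cup\mathcal{A}_{j_k,r}$ and $j_{k-1}\ne j_k$: (a) $\phi(Z_1\cdots Z_m)=\phi(Z_1)\cdots\phi(Z_m)$ whenever $Z_1,\dots,Z_m$ are Boolean products; (b) $\phi(Z_1\cdots Z_m)=0$ whenever there exist $1\le l_1<l_2\le m$ such that $Z_{l_1},Z_{l_1+1},\dots,Z_{l_2}$ are not Boolean products, $Z_{l_1-1}$ is a Boolean product or $l_1=1$, $Z_{l_2+1}$ is a Boolean product or $l_2=m$, and $\phi(Z_{l_1})=\phi(Z_{l_1+1})=\cdots=\phi(Z_{l_2})=0$.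
   Context: All vector spaces and algebras are over $\mathbb{C}$. A noncommutative probability space is a pair $(\mathcal{A},\phi)$ with $\mathcal{A}$ a unital algebra and $\phi:\mathcal{A}\to\mathbb{C}$ linear with $\phi(1)=1$. The algebras $\mathcal{A}_{i,\ell}$ (left faces) and $\mathcal{A}_{i,r}$ (right faces) are subalgebras of $\mathcal{A}$, not necessarily unital, and homomorphisms are not required to be unital. **Boolean product.** Given $z_1,\dots,z_s\in\mathcal{A}_{i,\ell}\cup\mathcal{A}_{i,r}$ for some $i\in I$, their product $z_1\cdots z_s$ is called a Boolean product if $z_t\in\mathcal{A}_{i,r}$ for some $t$. **Reduced free products.** A vector space with a specified vector is a triple $(\mathcal{X},\mathcal{X}^\circ,\xi)$, where $\mathcal{X}^\circ\subset\mathcal{X}$ is a subspace of codimension 1 and $\xi\in\mathcal{X}\setminus\mathcal{X}^\circ$. On the algebra $\mathcal{L}(\mathcal{X})$ of linear operators, $\phi_\xi(T)$ is the coefficient of $\xi$ in $T\xi$ relative to $\mathcal{X}=\mathbb{C}\xi\oplus\mathcal{X}^\circ$. The reduced free product of $(\mathcal{X}_i,\mathcal{X}_i^\circ,\xi_i)_{i\in I}$ is $(\mathcal{X},\mathcal{X}^\circ,\xi)$ with $\mathcal{X}=\mathbb{C}\xi\oplus\mathcal{X}^\circ$ and $\mathcal{X}^\circ=\bigoplus_{n\ge1}\bigoplus_{i_1\ne i_2\ne\cdots\ne i_n}\mathcal{X}_{i_1}^\circ\otimes\cdots\otimes\mathcal{X}_{i_n}^\circ$ (consecutive indices distinct). $\mathcal{X}(\ell,i)$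 is the sum of $\mathbb{C}\xi$ and the summands with $i_1\ne i$; $V_i:\mathcal{X}_i\otimes\mathcal{X}(\ell,i)\to\mathcal{X}$ is the natural isomorphism ($\xi_i\otimes\xi\mapsto\xi$, $\xi_i\otimes w\mapsto w$, $x\otimes\xi\mapsto x$, $x\otimes w\mapsto x\otimes w$ for $x\in\mathcal{X}_i^\circ$ and $w$ in a summand of $\mathcal{X}(\ell,i)$ other than $\mathbb{C}\xi$); and $\lambda_i(T)=V_i(T\otimes I)V_i^{-1}$ for $T\in\mathcal{L}(\mathcal{X}_i)$. $P_{\uplus,i}$ is the projection of $\mathcal{X}$ onto $\mathbb{C}\xi\oplus\mathcal{X}_i^\circ$ vanishing on all other summands. **Free-Boolean independence.** The family $(\mathcal{A}_{i,\ell},\mathcal{A}_{i,r})_{i\in I}$ is free-Boolean independent if there are vector spaces with specified vectors $(\mathcal{X}_i,\mathcal{X}_i^\circ,\xi_i)_{i\in I}$ and homomorphisms $\ell_i:\mathcal{A}_{i,\ell}\to\mathcal{L}(\mathcal{X}_i)$, $r_i:\mathcal{A}_{i,r}\to\mathcal{L}(\mathcal{X}_i)$ such that every mixed moment of elements of the faces with respect to $\phi$ equals the moment with respect to $\phi_\xi$ of their images under $\lambda_i(\ell_i(\cdot))$ on $\mathcal{A}_{i,\ell}$ and $P_{\uplus,i}\lambda_i(r_i(\cdot))P_{\uplus,i}$ on $\mathcal{A}_{i,r}$, acting on the reduced free product of the $\mathcal{X}_i$.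
   Formalization: Corrected: (b) is taken with l_1 ≤ l_2 instead of l_1 < l_2, and the "if" direction assumes 1 in every left face; both are needed, as "if" fails otherwise. The union of left and right faces is read as a disjoint union. *)

theory Defs
  imports Complex_Main "HOL-Library.Poly_Mapping"
begin

section \<open>Noncommutative probability spaces and pairs of faces\<close>

text \<open>The distribution has no class of complex algebras, so the scalar multiplication is explicit;
  the algebra is the whole type.\<close>

locale nc_prob_space = vector_space scale
  for scale :: "complex \<Rightarrow> 'a::ring_1 \<Rightarrow> 'a" +
  fixes \<phi> :: "'a \<Rightarrow> complex"
  assumes scale_mult_left: "scale c x * y = scale c (x * y)"
    and scale_mult_right: "x * scale c y = scale c (x * y)"
    and linear_\<phi>: "Vector_Spaces.linear scale (*) \<phi>"
    and \<phi>_one: "\<phi> 1 = 1"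

text \<open>Subalgebras need not contain the unit.\<close>

definition nonunital_subalgebra :: "(complex \<Rightarrow> 'a::ring_1 \<Rightarrow> 'a) \<Rightarrow> 'a set \<Rightarrow> bool" where
  "nonunital_subalgebra scale S \<longleftrightarrow> module.subspace scale S \<and> (\<forall>x\<in>S. \<forall>y\<in>S. x * y \<in> S)"

text \<open>The left and the right face with the same index may overlap, and an element of the overlap
  acts in two different ways in the definition of free-Boolean independence.  The union of the two
  faces is therefore taken as a disjoint union: a factor records the face it is taken from.\<close>

datatype 'a factor = Lft (elem: 'a) | Rgt (elem: 'a)

definition faces :: "('i \<Rightarrow> 'a set) \<Rightarrow> ('i \<Rightarrow> 'a set) \<Rightarrow> 'i \<Rightarrow> 'a factor set" where
  "faces Al Ar i = Lft ` Al i \<union> Rgt ` Ar i"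

definition factor_product :: "'a::monoid_mult factor list \<Rightarrow> 'a" where
  "factor_product zs = prod_list (map elem zs)"

definition boolean_product :: "'a factor list \<Rightarrow> bool" where
  "boolean_product zs \<longleftrightarrow> (\<exists>z\<in>set zs. \<exists>a. z = Rgt a)"


section \<open>Reduced free products\<close>

text \<open>The space \<open>X i\<close> is a subspace of an ambient complex vector space, given by the type \<open>'v\<close> and
  the scalar multiplication \<open>sv\<close>.  The equation for \<open>X i\<close>, with \<open>\<xi> i \<notin> Xo i\<close>, says that \<open>Xo i\<close> has
  codimension 1 in \<open>X i\<close> and that \<open>\<xi> i \<in> X i - Xo i\<close>.  \<open>B i\<close> is a Hamel basis of \<open>Xo i\<close>; it
  serves to write tensor products as spaces of finitely supported functions.\<close>

locale specified_family = vector_space sv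
  for sv :: "complex \<Rightarrow> 'v::ab_group_add \<Rightarrow> 'v" +
  fixes X Xo :: "'i \<Rightarrow> 'v set" and \<xi> :: "'i \<Rightarrow> 'v" and B :: "'i \<Rightarrow> 'v set"
  assumes subspace_X: "subspace (X i)"
    and subspace_Xo: "subspace (Xo i)"
    and \<xi>_notin: "\<xi> i \<notin> Xo i"
    and X_eq: "X i = {sv c (\<xi> i) + x |c x. x \<in> Xo i}"
    and independent_B: "independent (B i)"
    and span_B: "span (B i) = Xo i"

text \<open>The vector space with basis \<open>S\<close> is \<open>free_space S\<close>, the basis vector of \<open>k\<close> is \<open>basis_vec k\<close>,
  and \<open>linear_ext g\<close> is the linear map sending \<open>basis_vec k\<close> to \<open>g k\<close>.\<close>

definition free_space :: "'k set \<Rightarrow> ('k \<Rightarrow>\<^sub>0 complex) set" where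
  "free_space S = {F. Poly_Mapping.keys F \<subseteq> S}"

definition basis_vec :: "'k \<Rightarrow> 'k \<Rightarrow>\<^sub>0 complex" where
  "basis_vec k = Poly_Mapping.single k 1"

definition linear_ext :: "('k \<Rightarrow> ('l \<Rightarrow>\<^sub>0 complex)) \<Rightarrow> ('k \<Rightarrow>\<^sub>0 complex) \<Rightarrow> ('l \<Rightarrow>\<^sub>0 complex)" where
  "linear_ext g F =
     (\<Sum>k\<in>Poly_Mapping.keys F. Poly_Mapping.map (\<lambda>z. Poly_Mapping.lookup F k * z) (g k))"

context specified_family
begin

text \<open>The word \<open>[(i\<^sub>1,b\<^sub>1), \<dots>, (i\<^sub>n,b\<^sub>n)]\<close> stands for the basis vector \<open>b\<^sub>1 \<otimes> \<dots> \<otimes> b\<^sub>n\<close> of the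
  summand \<open>Xo i\<^sub>1 \<otimes> \<dots> \<otimes> Xo i\<^sub>n\<close>, and the empty word for \<open>\<xi>\<close>.\<close>

definition words :: "('i \<times> 'v) list set" where
  "words = {w. distinct_adj (map fst w) \<and> (\<forall>(i, b)\<in>set w. b \<in> B i)}"

definition words_left :: "'i \<Rightarrow> ('i \<times> 'v) list set" where
  "words_left i = {w \<in> words. w = [] \<or> fst (hd w) \<noteq> i}"

definition free_product :: "(('i \<times> 'v) list \<Rightarrow>\<^sub>0 complex) set" where
  "free_product = free_space words"

definition vacuum :: "('i \<times> 'v) list \<Rightarrow>\<^sub>0 complex" where
  "vacuum = basis_vec []"

definition \<phi>\<^sub>\<xi> :: "((('i \<times> 'v) list \<Rightarrow>\<^sub>0 complex) \<Rightarrow> (('i \<times> 'v) list \<Rightarrow>\<^sub>0 complex)) \<Rightarrow> complex" where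
  "\<phi>\<^sub>\<xi> T = Poly_Mapping.lookup (T vacuum) []"

text \<open>\<open>X i \<otimes> \<X>(\<ell>,i)\<close> in the basis of the vectors \<open>b \<otimes> w\<close>, where \<open>b\<close> runs through the basis
  \<open>basis_X i\<close> of \<open>X i\<close> and \<open>w\<close> through \<open>words_left i\<close>.\<close>

definition basis_X :: "'i \<Rightarrow> 'v set" where
  "basis_X i = insert (\<xi> i) (B i)"

definition tensor_left :: "'i \<Rightarrow> ('v \<times> ('i \<times> 'v) list \<Rightarrow>\<^sub>0 complex) set" where
  "tensor_left i = free_space (basis_X i \<times> words_left i)"

definition V :: "'i \<Rightarrow> ('v \<times> ('i \<times> 'v) list \<Rightarrow>\<^sub>0 complex) \<Rightarrow> (('i \<times> 'v) list \<Rightarrow>\<^sub>0 complex)" where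
  "V i = linear_ext (\<lambda>(b, w). basis_vec (if b = \<xi> i then w else (i, b) # w))"

definition V_inv :: "'i \<Rightarrow> (('i \<times> 'v) list \<Rightarrow>\<^sub>0 complex) \<Rightarrow> ('v \<times> ('i \<times> 'v) list \<Rightarrow>\<^sub>0 complex)" where
  "V_inv i = linear_ext (\<lambda>w. basis_vec
     (if w \<noteq> [] \<and> fst (hd w) = i then (snd (hd w), tl w) else (\<xi> i, w)))"

text \<open>The operator \<open>T \<otimes> I\<close> on \<open>X i \<otimes> \<X>(\<ell>,i)\<close>.\<close>

definition tensor_id ::
  "'i \<Rightarrow> ('v \<Rightarrow> 'v) \<Rightarrow> ('v \<times> ('i \<times> 'v) list \<Rightarrow>\<^sub>0 complex) \<Rightarrow> ('v \<times> ('i \<times> 'v) list \<Rightarrow>\<^sub>0 complex)" where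
  "tensor_id i T = linear_ext (\<lambda>(b, w).
     \<Sum>b' | representation (basis_X i) (T b) b' \<noteq> 0.
       Poly_Mapping.single (b', w) (representation (basis_X i) (T b) b'))"

definition lam ::
  "'i \<Rightarrow> ('v \<Rightarrow> 'v) \<Rightarrow> (('i \<times> 'v) list \<Rightarrow>\<^sub>0 complex) \<Rightarrow> (('i \<times> 'v) list \<Rightarrow>\<^sub>0 complex)" where
  "lam i T = V i \<circ> tensor_id i T \<circ> V_inv i"

definition proj :: "'i \<Rightarrow> (('i \<times> 'v) list \<Rightarrow>\<^sub>0 complex) \<Rightarrow> (('i \<times> 'v) list \<Rightarrow>\<^sub>0 complex)" where
  "proj i = linear_ext (\<lambda>w. if w = [] \<or> (\<exists>b. w = [(i, b)]) then basis_vec w else 0)"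

end


subsection \<open>Elementary properties, confirming the encoding\<close>

lemma lookup_map_mult [simp]:
  "Poly_Mapping.lookup (Poly_Mapping.map (\<lambda>z. c * z) F) k = (c * Poly_Mapping.lookup F k :: complex)"
  by (simp add: Poly_Mapping.map.rep_eq when_def)

lemma lookup_linear_ext:
  "Poly_Mapping.lookup (linear_ext g F) l =
     (\<Sum>k\<in>Poly_Mapping.keys F. Poly_Mapping.lookup F k * Poly_Mapping.lookup (g k) l)"
  by (simp add: linear_ext_def lookup_sum)

lemma linear_ext_basis_vec [simp]: "linear_ext g (basis_vec k) = g k"
  by (rule poly_mapping_eqI) (simp add: lookup_linear_ext, simp add: basis_vec_def)

lemma lookup_linear_ext_superset:
  assumes "finite S" "Poly_Mapping.keys F \<subseteq> S"
  shows "Poly_Mapping.lookup (linear_ext g F) l =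
     (\<Sum>k\<in>S. Poly_Mapping.lookup F k * Poly_Mapping.lookup (g k) l)"
  unfolding lookup_linear_ext using assms
  by (intro sum.mono_neutral_left) (auto simp: in_keys_iff)

lemma linear_ext_add: "linear_ext g (F + G) = linear_ext g F + linear_ext g G"
proof (rule poly_mapping_eqI)
  fix l
  let ?S = "Poly_Mapping.keys F \<union> Poly_Mapping.keys G"
  have *: "finite ?S" "Poly_Mapping.keys F \<subseteq> ?S" "Poly_Mapping.keys G \<subseteq> ?S"
    "Poly_Mapping.keys (F + G) \<subseteq> ?S"
    by (auto dest: subsetD[OF keys_add])
  show "Poly_Mapping.lookup (linear_ext g (F + G)) l =
      Poly_Mapping.lookup (linear_ext g F + linear_ext g G) l"
    unfolding lookup_add lookup_linear_ext_superset[OF *(1,2)]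
      lookup_linear_ext_superset[OF *(1,3)] lookup_linear_ext_superset[OF *(1,4)]
    by (simp add: lookup_add distrib_right sum.distrib)
qed

lemma linear_ext_zero [simp]: "linear_ext g 0 = 0"
  by (simp add: linear_ext_def)

lemma linear_ext_sum: "linear_ext g (sum F S) = (\<Sum>s\<in>S. linear_ext g (F s))"
  by (induction S rule: infinite_finite_induct) (auto simp: linear_ext_add)

lemma map_mult_single: "Poly_Mapping.map (\<lambda>z. c * z) (Poly_Mapping.single k d) =
    Poly_Mapping.single k (c * d :: complex)"
  by (rule poly_mapping_eqI) (auto simp: lookup_single when_def)

lemma linear_ext_scale:
  "linear_ext g (Poly_Mapping.map (\<lambda>z. c * z) F) = Poly_Mapping.map (\<lambda>z. c * z) (linear_ext g F)"
proof (rule poly_mapping_eqI)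
  fix l
  have *: "finite (Poly_Mapping.keys F)"
    "Poly_Mapping.keys (Poly_Mapping.map (\<lambda>z. c * z) F) \<subseteq> Poly_Mapping.keys F"
    by (auto simp: in_keys_iff)
  show "Poly_Mapping.lookup (linear_ext g (Poly_Mapping.map (\<lambda>z. c * z) F)) l =
      Poly_Mapping.lookup (Poly_Mapping.map (\<lambda>z. c * z) (linear_ext g F)) l"
    unfolding lookup_linear_ext_superset[OF *]
    by (simp add: lookup_linear_ext sum_distrib_left mult.assoc)
qed

lemma linear_ext_single:
  "linear_ext g (Poly_Mapping.single k c) = Poly_Mapping.map (\<lambda>z. c * z) (g k)"
  by (metis basis_vec_def linear_ext_basis_vec linear_ext_scale map_mult_single mult.right_neutral)

lemma linear_ext_cong_id:
  assumes "\<And>k. k \<in> Poly_Mapping.keys F \<Longrightarrow> f (g k) = basis_vec k"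
    and "\<And>G. f G = linear_ext h G"
  shows "f (linear_ext g F) = F"
proof -
  have "f (linear_ext g F) =
      (\<Sum>k\<in>Poly_Mapping.keys F. Poly_Mapping.map (\<lambda>z. Poly_Mapping.lookup F k * z) (f (g k)))"
    unfolding assms(2) by (simp add: linear_ext_def[of g] linear_ext_sum linear_ext_scale)
  also have "\<dots> = linear_ext basis_vec F"
    unfolding linear_ext_def by (intro sum.cong refl) (simp add: assms(1))
  also have "\<dots> = F"
  proof (rule poly_mapping_eqI)
    fix l
    have "Poly_Mapping.lookup F k * Poly_Mapping.lookup (basis_vec k) l =
        (if k = l then Poly_Mapping.lookup F k else 0)" for k
      by (simp add: basis_vec_def lookup_single when_def)
    thus "Poly_Mapping.lookup (linear_ext basis_vec F) l = Poly_Mapping.lookup F l"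
      by (simp add: lookup_linear_ext in_keys_iff)
  qed
  finally show ?thesis .
qed

context specified_family
begin

lemma \<xi>_notin_B: "\<xi> i \<notin> B i"
  using \<xi>_notin span_B span_superset by blast

lemma independent_basis_X: "independent (basis_X i)"
  unfolding basis_X_def using independent_insert \<xi>_notin_B span_B \<xi>_notin independent_B by metis

lemma span_basis_X: "span (basis_X i) = X i"
proof -
  have "(\<exists>c. x - sv c (\<xi> i) \<in> Xo i) \<longleftrightarrow> (\<exists>c y. x = sv c (\<xi> i) + y \<and> y \<in> Xo i)" for x
    by (metis add_diff_cancel_left' add_diff_eq diff_add_cancel add.commute)
  thus ?thesis by (simp add: basis_X_def span_insert span_B X_eq)
qed

lemma V_V_inv:
  assumes "F \<in> free_product"
  shows "V i (V_inv i F) = F"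
  unfolding V_inv_def
proof (rule linear_ext_cong_id[where f = "V i"])
  fix w assume "w \<in> Poly_Mapping.keys F"
  hence "w \<in> words" using assms by (auto simp: free_product_def free_space_def)
  thus "V i (basis_vec (if w \<noteq> [] \<and> fst (hd w) = i then (snd (hd w), tl w) else (\<xi> i, w))) =
      basis_vec w"
    using \<xi>_notin_B by (cases w) (auto simp: V_def words_def)
qed (simp add: V_def)

lemma V_inv_V: "F \<in> tensor_left i \<Longrightarrow> V_inv i (V i F) = F"
  unfolding V_def
  by (rule linear_ext_cong_id[where f = "V_inv i"])
    (auto simp: V_inv_def tensor_left_def free_space_def words_left_def split: if_splits)

end


section \<open>Free-Boolean independence\<close>

definition is_operator :: "(complex \<Rightarrow> 'v::ab_group_add \<Rightarrow> 'v) \<Rightarrow> 'v set \<Rightarrow> ('v \<Rightarrow> 'v) \<Rightarrow> bool" where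
  "is_operator sv X T \<longleftrightarrow>
     (\<forall>x\<in>X. T x \<in> X) \<and> (\<forall>x\<in>X. \<forall>y\<in>X. T (x + y) = T x + T y) \<and>
     (\<forall>c. \<forall>x\<in>X. T (sv c x) = sv c (T x))"

text \<open>Algebra homomorphisms, not required to be unital, from a nonunital_subalgebra \<open>S\<close> to the operators on the
  subspace \<open>X\<close>.\<close>

definition operator_hom ::
  "(complex \<Rightarrow> 'a::ring_1 \<Rightarrow> 'a) \<Rightarrow> (complex \<Rightarrow> 'v::ab_group_add \<Rightarrow> 'v) \<Rightarrow> 'a set \<Rightarrow> 'v set
     \<Rightarrow> ('a \<Rightarrow> 'v \<Rightarrow> 'v) \<Rightarrow> bool" where
  "operator_hom scale sv S X h \<longleftrightarrow>
     (\<forall>a\<in>S. is_operator sv X (h a)) \<and>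
     (\<forall>a\<in>S. \<forall>b\<in>S. \<forall>x\<in>X. h (a + b) x = h a x + h b x) \<and>
     (\<forall>c. \<forall>a\<in>S. \<forall>x\<in>X. h (scale c a) x = sv c (h a x)) \<and>
     (\<forall>a\<in>S. \<forall>b\<in>S. \<forall>x\<in>X. h (a * b) x = h a (h b x))"

context specified_family
begin

fun factor_op :: "('i \<Rightarrow> 'a \<Rightarrow> 'v \<Rightarrow> 'v) \<Rightarrow> ('i \<Rightarrow> 'a \<Rightarrow> 'v \<Rightarrow> 'v) \<Rightarrow> 'i \<times> 'a factor
     \<Rightarrow> (('i \<times> 'v) list \<Rightarrow>\<^sub>0 complex) \<Rightarrow> (('i \<times> 'v) list \<Rightarrow>\<^sub>0 complex)" where
  "factor_op L R (i, Lft a) = lam i (L i a)"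
| "factor_op L R (i, Rgt a) = proj i \<circ> lam i (R i a) \<circ> proj i"

text \<open>All moments in elements of the faces are compared, those of a single pair of faces included.\<close>

definition models :: "(complex \<Rightarrow> 'a::ring_1 \<Rightarrow> 'a) \<Rightarrow> ('a \<Rightarrow> complex) \<Rightarrow> ('i \<Rightarrow> 'a set) \<Rightarrow> ('i \<Rightarrow> 'a set)
     \<Rightarrow> ('i \<Rightarrow> 'a \<Rightarrow> 'v \<Rightarrow> 'v) \<Rightarrow> ('i \<Rightarrow> 'a \<Rightarrow> 'v \<Rightarrow> 'v) \<Rightarrow> bool" where
  "models scale \<phi> Al Ar L R \<longleftrightarrow>
     (\<forall>i. operator_hom scale sv (Al i) (X i) (L i) \<and> operator_hom scale sv (Ar i) (X i) (R i)) \<and>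
     (\<forall>zs. (\<forall>(i, z)\<in>set zs. z \<in> faces Al Ar i) \<longrightarrow>
        \<phi> (factor_product (map snd zs)) = \<phi>\<^sub>\<xi> (foldr (\<circ>) (map (factor_op L R) zs) id))"

end

text \<open>A formula of HOL cannot quantify over all types, hence over all vector spaces: the spaces
  \<open>X i\<close> range over the subspaces of the ambient space \<open>'v\<close> with scalar multiplication \<open>sv\<close>.\<close>

definition free_boolean_independent ::
  "(complex \<Rightarrow> 'v::ab_group_add \<Rightarrow> 'v) \<Rightarrow> (complex \<Rightarrow> 'a::ring_1 \<Rightarrow> 'a) \<Rightarrow> ('a \<Rightarrow> complex)
     \<Rightarrow> ('i \<Rightarrow> 'a set) \<Rightarrow> ('i \<Rightarrow> 'a set) \<Rightarrow> bool" where
  "free_boolean_independent sv scale \<phi> Al Ar \<longleftrightarrow>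
     (\<exists>X Xo \<xi> B L R. specified_family sv X Xo \<xi> B \<and>
        specified_family.models sv X \<xi> B scale \<phi> Al Ar L R)"


section \<open>Conditions on moments\<close>

text \<open>\<open>Z k\<close>, for \<open>1 \<le> k \<le> m\<close>, is the list of the factors \<open>z\<^sub>1\<^sub>,\<^sub>k, \<dots>, z\<^sub>s\<^sub>,\<^sub>k\<close> of the \<open>k\<close>-th product.\<close>

definition alternating_products ::
  "('i \<Rightarrow> 'a set) \<Rightarrow> ('i \<Rightarrow> 'a set) \<Rightarrow> nat \<Rightarrow> (nat \<Rightarrow> 'i) \<Rightarrow> (nat \<Rightarrow> 'a factor list) \<Rightarrow> bool" where
  "alternating_products Al Ar m j Z \<longleftrightarrow>
     (\<forall>k\<in>{1..m}. Z k \<noteq> [] \<and> set (Z k) \<subseteq> faces Al Ar (j k)) \<and>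
     (\<forall>k\<in>{2..m}. j (k - 1) \<noteq> j k)"

definition total_product :: "nat \<Rightarrow> (nat \<Rightarrow> 'a::monoid_mult factor list) \<Rightarrow> 'a" where
  "total_product m Z = prod_list (map (\<lambda>k. factor_product (Z k)) [1..<Suc m])"

definition boolean_condition ::
  "('a::monoid_mult \<Rightarrow> complex) \<Rightarrow> nat \<Rightarrow> (nat \<Rightarrow> 'a factor list) \<Rightarrow> bool" where
  "boolean_condition \<phi> m Z \<longleftrightarrow>
     ((\<forall>k\<in>{1..m}. boolean_product (Z k)) \<longrightarrow>
        \<phi> (total_product m Z) = (\<Prod>k=1..m. \<phi> (factor_product (Z k))))"

text \<open>The run of products without right factor from \<open>l\<^sub>1\<close> to \<open>l\<^sub>2\<close> may have length 1.  Runs of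
  length at least 2 only would not determine \<open>\<phi> (Z\<^sub>1 * Z\<^sub>2)\<close> for \<open>Z\<^sub>1\<close> a Boolean product and
  \<open>Z\<^sub>2\<close> not.\<close>

definition free_condition ::
  "('a::monoid_mult \<Rightarrow> complex) \<Rightarrow> nat \<Rightarrow> (nat \<Rightarrow> 'a factor list) \<Rightarrow> bool" where
  "free_condition \<phi> m Z \<longleftrightarrow>
     ((\<exists>l\<^sub>1 l\<^sub>2. 1 \<le> l\<^sub>1 \<and> l\<^sub>1 \<le> l\<^sub>2 \<and> l\<^sub>2 \<le> m \<and>
         (\<forall>k\<in>{l\<^sub>1..l\<^sub>2}. \<not> boolean_product (Z k)) \<and>
         (boolean_product (Z (l\<^sub>1 - 1)) \<or> l\<^sub>1 = 1) \<and>
         (boolean_product (Z (l\<^sub>2 + 1)) \<or> l\<^sub>2 = m) \<and>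
         (\<forall>k\<in>{l\<^sub>1..l\<^sub>2}. \<phi> (factor_product (Z k)) = 0)) \<longrightarrow>
        \<phi> (total_product m Z) = 0)"

text \<open>When an element of a left face has to be centered, \<open>a - \<phi> a \<cdot> 1\<close> lies in the left face if
  that face contains \<open>1\<close>; the conditions determine the mixed moments in this case, but not for
  arbitrary left faces.  For instance, let \<open>p\<close> be an idempotent of \<open>\<complex>\<^sup>2\<close> with \<open>\<phi> p = 1/2\<close>, all left
  faces equal to \<open>\<complex>p\<close> and all right faces zero.  The conditions hold trivially, but
  \<open>\<phi> (p * p) \<noteq> \<phi> p * \<phi> p\<close>.\<close>

definition moment_conditions ::
  "('a::monoid_mult \<Rightarrow> complex) \<Rightarrow> ('i \<Rightarrow> 'a set) \<Rightarrow> ('i \<Rightarrow> 'a set) \<Rightarrow> bool" where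
  "moment_conditions \<phi> Al Ar \<longleftrightarrow>
     (\<forall>m j Z. alternating_products Al Ar m j Z \<longrightarrow> boolean_condition \<phi> m Z \<and> free_condition \<phi> m Z)"

end

theory Submission
  imports Defs
begin

text \<open>Both directions rest on one fact: in any reduced free product, for any operators on the spaces
  \<open>X i\<close>, the vacuum moments satisfy the two conditions
  (\<open>op_moment_block_conditions\<close>).  Writing \<open>\<X> = X i \<otimes> \<X>(\<ell>,i)\<close>, the operator \<open>lam i T\<close> acts on the
  first leg and the projection \<open>proj i\<close> on the second, projecting onto \<open>X i \<otimes> \<xi>\<close>.  They commute, so
  a block of factors with index \<open>i\<close> acts as a single \<open>lam i T\<close>, followed by \<open>proj i\<close> exactly if the
  block is a Boolean product.  A Boolean block thus produces a vector in \<open>\<complex>\<xi> \<oplus> Xo i\<close>, of which the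
  next block to the left, if it is Boolean with another index, sees only the vacuum component: the
  moments factorize.  A left block with vanishing moment, applied to words that do not start with
  its index, adds a letter in front.  A maximal run of such blocks therefore leads to words without
  vacuum component that start with the index of the leftmost block of the run, and these are
  annihilated by a Boolean block with a different index, or have vanishing vacuum coefficient if no
  block is left.

  If the family is free-Boolean independent, the moments of \<open>\<phi>\<close> are such vacuum moments, so they
  satisfy the conditions.

  Conversely, if the left faces contain the unit, two moment functionals that satisfy the conditions
  and agree on the words in a single pair of faces agree everywhere (\<open>block_conditions_unique\<close>): if all
  blocks are Boolean, both factorize; otherwise the blocks of a maximal run of left blocks can be
  centered, at the price of shorter words, and both functionals vanish on the centered word.  It
  remains to find one model with the right moments on single pairs of faces.  The left regular
  representation of the algebra, with the unit as specified vector and the kernel of \<open>\<phi>\<close> as its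
  complement, is one for every index at once.\<close>

section \<open>Words in the faces and their blocks\<close>

definition valid_word :: "('i \<Rightarrow> 'a set) \<Rightarrow> ('i \<Rightarrow> 'a set) \<Rightarrow> ('i \<times> 'a factor) list \<Rightarrow> bool" where
  "valid_word Al Ar zs \<longleftrightarrow> (\<forall>(i, z)\<in>set zs. z \<in> faces Al Ar i)"

definition flatten_blocks :: "('i \<times> 'f list) list \<Rightarrow> ('i \<times> 'f) list" where
  "flatten_blocks bs = concat (map (\<lambda>(i, l). map (Pair i) l) bs)"

definition alternating_blocks ::
  "('i \<Rightarrow> 'a set) \<Rightarrow> ('i \<Rightarrow> 'a set) \<Rightarrow> ('i \<times> 'a factor list) list \<Rightarrow> bool" where
  "alternating_blocks Al Ar bs \<longleftrightarrow>
     distinct_adj (map fst bs) \<and> (\<forall>(i, l)\<in>set bs. l \<noteq> [] \<and> set l \<subseteq> faces Al Ar i)"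

text \<open>The two conditions of the theorem, for an arbitrary functional on words instead of the
  moments of \<open>\<phi>\<close>: the moments of operators on a reduced free product have to satisfy them as well,
  and they are given on words, not as values of a state on a ring.  A maximal run of blocks
  without right factor is given by a splitting of the list of blocks.\<close>

definition block_conditions ::
  "('i \<Rightarrow> 'a set) \<Rightarrow> ('i \<Rightarrow> 'a set) \<Rightarrow> (('i \<times> 'a factor) list \<Rightarrow> complex) \<Rightarrow> bool" where
  "block_conditions Al Ar M \<longleftrightarrow>
     (\<forall>bs. alternating_blocks Al Ar bs \<and> (\<forall>b\<in>set bs. boolean_product (snd b)) \<longrightarrow>
        M (flatten_blocks bs) = (\<Prod>b\<leftarrow>bs. M (flatten_blocks [b]))) \<and>
     (\<forall>us rs vs. alternating_blocks Al Ar (us @ rs @ vs) \<and> rs \<noteq> [] \<and>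
        (\<forall>b\<in>set rs. \<not> boolean_product (snd b) \<and> M (flatten_blocks [b]) = 0) \<and>
        (us = [] \<or> boolean_product (snd (last us))) \<and>
        (vs = [] \<or> boolean_product (snd (hd vs))) \<longrightarrow>
        M (flatten_blocks (us @ rs @ vs)) = 0)"

lemma flatten_blocks_simps [simp]:
  "flatten_blocks [] = []"
  "flatten_blocks ((i, l) # bs) = map (Pair i) l @ flatten_blocks bs"
  "flatten_blocks (bs @ cs) = flatten_blocks bs @ flatten_blocks cs"
  by (auto simp: flatten_blocks_def)

lemma valid_word_simps [simp]:
  "valid_word Al Ar []"
  "valid_word Al Ar ((i, z) # zs) \<longleftrightarrow> z \<in> faces Al Ar i \<and> valid_word Al Ar zs"
  "valid_word Al Ar (zs @ zs') \<longleftrightarrow> valid_word Al Ar zs \<and> valid_word Al Ar zs'"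
  "valid_word Al Ar (map (Pair i) l) \<longleftrightarrow> set l \<subseteq> faces Al Ar i"
  by (auto simp: valid_word_def)

lemma alternating_blocks_append:
  "alternating_blocks Al Ar (bs @ cs) \<longleftrightarrow>
     alternating_blocks Al Ar bs \<and> alternating_blocks Al Ar cs \<and>
     (bs = [] \<or> cs = [] \<or> fst (last bs) \<noteq> fst (hd cs))"
  by (auto simp: alternating_blocks_def distinct_adj_append_iff last_map hd_map)

lemma alternating_blocks_Cons:
  "alternating_blocks Al Ar ((i, l) # bs) \<longleftrightarrow>
     l \<noteq> [] \<and> set l \<subseteq> faces Al Ar i \<and> alternating_blocks Al Ar bs \<and> (bs = [] \<or> i \<noteq> fst (hd bs))"
  by (auto simp: alternating_blocks_def distinct_adj_Cons hd_map)

lemma alternating_blocks_Nil [simp]: "alternating_blocks Al Ar []"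
  by (simp add: alternating_blocks_def)

lemma valid_word_flatten: "alternating_blocks Al Ar bs \<Longrightarrow> valid_word Al Ar (flatten_blocks bs)"
  by (induction bs) (auto simp: alternating_blocks_Cons)

lemma valid_word_blocks:
  assumes "valid_word Al Ar zs"
  obtains bs where "alternating_blocks Al Ar bs" "flatten_blocks bs = zs"
proof -
  have "\<exists>bs. alternating_blocks Al Ar bs \<and> flatten_blocks bs = zs"
    using assms
  proof (induction zs)
    case Nil
    show ?case by (intro exI[of _ "[]"]) simp
  next
    case (Cons iz zs)
    obtain i z where [simp]: "iz = (i, z)" by (cases iz)
    from Cons obtain bs where bs: "alternating_blocks Al Ar bs" "flatten_blocks bs = zs"
      and z: "z \<in> faces Al Ar i" by auto
    show ?case
    proof (cases "bs \<noteq> [] \<and> fst (hd bs) = i")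
      case True
      then obtain l bs' where "bs = (i, l) # bs'" by (cases bs) auto
      with bs z show ?thesis
        by (intro exI[of _ "(i, z # l) # bs'"]) (auto simp: alternating_blocks_Cons)
    next
      case False
      with bs z show ?thesis
        by (intro exI[of _ "(i, [z]) # bs"]) (auto simp: alternating_blocks_Cons)
    qed
  qed
  thus ?thesis using that by blast
qed

lemma maximal_run:
  assumes "\<exists>b\<in>set bs. \<not> P b"
  obtains us rs vs where "bs = us @ rs @ vs" "rs \<noteq> []" "\<forall>b\<in>set rs. \<not> P b"
    "us = [] \<or> P (last us)" "vs = [] \<or> P (hd vs)"
proof -
  define us where "us = takeWhile P bs"
  define ds where "ds = dropWhile P bs"
  define rs where "rs = takeWhile (\<lambda>b. \<not> P b) ds"
  define vs where "vs = dropWhile (\<lambda>b. \<not> P b) ds"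
  have "ds \<noteq> []" using assms by (auto simp: ds_def)
  moreover have "\<not> P (hd ds)" using calculation hd_dropWhile unfolding ds_def by blast
  ultimately have "rs \<noteq> []" unfolding rs_def by (cases ds) auto
  moreover have "bs = us @ rs @ vs" by (simp add: us_def ds_def rs_def vs_def)
  moreover have "\<forall>b\<in>set rs. \<not> P b" by (auto simp: rs_def dest: set_takeWhileD)
  moreover have "us = [] \<or> P (last us)"
    unfolding us_def by (metis last_in_set set_takeWhileD)
  moreover have "vs = [] \<or> P (hd vs)" using hd_dropWhile[of "\<lambda>b. \<not> P b" ds] by (auto simp: vs_def)
  ultimately show ?thesis using that by blast
qed

lemma not_boolean_product:
  assumes "\<not> boolean_product l" "set l \<subseteq> faces Al Ar i"
  obtains as where "l = map Lft as" "set as \<subseteq> Al i"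
proof -
  have "l = map Lft (map elem l)"
    using assms(1) by (auto simp: boolean_product_def intro!: nth_equalityI)
      (metis factor.exhaust_sel nth_mem)
  moreover have "set (map elem l) \<subseteq> Al i"
    using assms by (fastforce simp: boolean_product_def faces_def)
  ultimately show ?thesis using that by blast
qed

lemma boolean_product_simps [simp]:
  "\<not> boolean_product []"
  "boolean_product (Lft a # l) \<longleftrightarrow> boolean_product l"
  "boolean_product (Rgt a # l)"
  by (auto simp: boolean_product_def)

lemma boolean_product_map_Lft [simp]: "\<not> boolean_product (map Lft as)"
  by (auto simp: boolean_product_def)


section \<open>The conditions determine a functional from its values on single pairs of faces\<close>

text \<open>This is what a moment functional retains of multiplicativity and linearity on the left
  faces: a block \<open>a\<^sub>1 \<cdots> a\<^sub>s\<close> of left factors may be written as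
  \<open>(a\<^sub>1 \<cdots> a\<^sub>s - c \<cdot> 1) + c \<cdot> 1\<close>, where the factor \<open>1\<close> can be left out.\<close>

definition admits_centering ::
  "(complex \<Rightarrow> 'a::ring_1 \<Rightarrow> 'a) \<Rightarrow> (('i \<times> 'a factor) list \<Rightarrow> complex) \<Rightarrow> bool" where
  "admits_centering scale M \<longleftrightarrow> (\<forall>i as c us vs.
     M (us @ map (Pair i) (map Lft as) @ vs) =
       M (us @ [(i, Lft (prod_list as - scale c 1))] @ vs) + c * M (us @ vs))"

text \<open>Two functionals satisfying the conditions agree by induction on the length of the word.  If
  every block is Boolean, the word factorizes.  Otherwise the blocks of a maximal run of left
  blocks are centered one after the other, from left to right.  Each centering leaves a multiple
  of a shorter word, and when the whole run is centered, both functionals vanish.\<close>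

lemma block_conditions_unique:
  fixes Al Ar :: "'i \<Rightarrow> 'a::ring_1 set"
  assumes M: "block_conditions Al Ar M" "admits_centering scale M"
    and N: "block_conditions Al Ar N" "admits_centering scale N"
    and single: "\<And>i l. set l \<subseteq> faces Al Ar i \<Longrightarrow> M (map (Pair i) l) = N (map (Pair i) l)"
    and M_Nil: "M [] = 1"
    and left: "\<And>i as c. set as \<subseteq> Al i \<Longrightarrow> prod_list as - scale c 1 \<in> Al i"
    and "valid_word Al Ar zs"
  shows "M zs = N zs"
  using \<open>valid_word Al Ar zs\<close>
proof (induction zs rule: length_induct)
  case (1 zs)
  hence shorter: "M ys = N ys" if "length ys < length zs" "valid_word Al Ar ys" for ys
    using that by blast
  have N_Nil: "N [] = 1" using single[of "[]"] M_Nil by simp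
  obtain bs where bs: "alternating_blocks Al Ar bs" "flatten_blocks bs = zs"
    using valid_word_blocks 1(2) by blast
  show ?case
  proof (cases "\<forall>b\<in>set bs. boolean_product (snd b)")
    case True
    have "M zs = (\<Prod>b\<leftarrow>bs. M (flatten_blocks [b]))"
      using M(1) bs True unfolding block_conditions_def by metis
    also have "\<dots> = (\<Prod>b\<leftarrow>bs. N (flatten_blocks [b]))"
      using bs(1) by (intro arg_cong[of _ _ prod_list] map_cong refl)
        (auto simp: alternating_blocks_def intro!: single)
    also have "\<dots> = N zs"
      using N(1) bs True unfolding block_conditions_def by metis
    finally show ?thesis .
  next
    case False
    then obtain us rs vs where split: "bs = us @ rs @ vs" "rs \<noteq> []"
      "\<forall>b\<in>set rs. \<not> boolean_product (snd b)"
      "us = [] \<or> boolean_product (snd (last us))" "vs = [] \<or> boolean_product (snd (hd vs))"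
      using maximal_run[of bs "\<lambda>b. boolean_product (snd b)"] by blast
    \<comment> \<open>Here \<open>ps\<close> is the part of the run that is centered already, and \<open>qs\<close> the rest.\<close>
    have centered: "M (flatten_blocks (us @ ps @ qs @ vs)) = N (flatten_blocks (us @ ps @ qs @ vs))"
      if "alternating_blocks Al Ar (us @ ps @ qs @ vs)" "ps @ qs \<noteq> []"
        "\<forall>b\<in>set ps. \<not> boolean_product (snd b) \<and> M (flatten_blocks [b]) = 0 \<and> N (flatten_blocks [b]) = 0"
        "\<forall>b\<in>set qs. \<not> boolean_product (snd b)"
        "length (flatten_blocks (us @ ps @ qs @ vs)) \<le> length zs" for ps qs
      using that
    proof (induction qs arbitrary: ps)
      case Nil
      have "M (flatten_blocks (us @ ps @ vs)) = 0"
        using M(1) Nil split(4,5) unfolding block_conditions_def by (metis append_Nil append_Nil2)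
      moreover have "N (flatten_blocks (us @ ps @ vs)) = 0"
        using N(1) Nil split(4,5) unfolding block_conditions_def by (metis append_Nil append_Nil2)
      ultimately show ?case by simp
    next
      case (Cons b qs)
      obtain i l where b: "b = (i, l)" by (cases b)
      have l: "l \<noteq> []" "set l \<subseteq> faces Al Ar i" "\<not> boolean_product l"
        using Cons.prems by (auto simp: b alternating_blocks_def)
      obtain as where as: "l = map Lft as" "set as \<subseteq> Al i"
        by (rule not_boolean_product[OF l(3,2)])
      define c where "c = M (map (Pair i) l)"
      have cN: "c = N (map (Pair i) l)" using single l(2) by (simp add: c_def)
      define d where "d = prod_list as - scale c 1"
      have d: "d \<in> Al i" using left as(2) by (simp add: d_def)
      have center: "K (xs @ map (Pair i) l @ ys) = K (xs @ [(i, Lft d)] @ ys) + c * K (xs @ ys)"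
        if "admits_centering scale K" for K xs ys
        using that unfolding admits_centering_def as(1) d_def by blast
      let ?p = "(i, [Lft d])"
      have alt: "alternating_blocks Al Ar (us @ (ps @ [?p]) @ qs @ vs)"
        using Cons.prems(1) d unfolding alternating_blocks_def b by (auto simp: faces_def)
      have "length l \<ge> 1" using l(1) by (cases l) auto
      hence len: "length (flatten_blocks (us @ (ps @ [?p]) @ qs @ vs)) \<le> length zs"
        "length (flatten_blocks (us @ ps) @ flatten_blocks (qs @ vs)) < length zs"
        using Cons.prems(5) by (auto simp: b)
      \<comment> \<open>Centering with respect to \<open>M\<close> also centers with respect to \<open>N\<close>, as both agree on a
        single block; the empty word accounts for the constant.\<close>
      have "M (flatten_blocks [?p]) = 0" "N (flatten_blocks [?p]) = 0"
        using center[OF M(2), of "[]" "[]"] center[OF N(2), of "[]" "[]"] M_Nil N_Nil c_def cN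
        by auto
      hence "M (flatten_blocks (us @ (ps @ [?p]) @ qs @ vs)) =
          N (flatten_blocks (us @ (ps @ [?p]) @ qs @ vs))"
        using Cons.prems len alt by (intro Cons.IH) (auto simp: boolean_product_def)
      moreover have "valid_word Al Ar (flatten_blocks (us @ ps) @ flatten_blocks (qs @ vs))"
        using valid_word_flatten[OF Cons.prems(1)] by (simp add: b)
      hence "M (flatten_blocks (us @ ps) @ flatten_blocks (qs @ vs)) =
          N (flatten_blocks (us @ ps) @ flatten_blocks (qs @ vs))"
        using len(2) by (intro shorter)
      ultimately show ?case
        using center[OF M(2), of "flatten_blocks (us @ ps)" "flatten_blocks (qs @ vs)"]
          center[OF N(2), of "flatten_blocks (us @ ps)" "flatten_blocks (qs @ vs)"]
        by (simp add: b)
    qed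
    have "zs = flatten_blocks (us @ [] @ rs @ vs)" using bs(2) split(1) by simp
    thus ?thesis using centered[of "[]" rs] bs(1) split(1-3) by simp
  qed
qed


section \<open>Operators on the reduced free product\<close>

lemma linear_ext_comp:
  "linear_ext g (linear_ext h F) = linear_ext (\<lambda>k. linear_ext g (h k)) F"
  by (simp add: linear_ext_def[of h] linear_ext_def[of "\<lambda>k. linear_ext g (h k)"]
      linear_ext_sum linear_ext_scale)

lemma keys_linear_ext:
  "Poly_Mapping.keys (linear_ext g F) \<subseteq> (\<Union>k\<in>Poly_Mapping.keys F. Poly_Mapping.keys (g k))"
proof
  fix l assume "l \<in> Poly_Mapping.keys (linear_ext g F)"
  hence "(\<Sum>k\<in>Poly_Mapping.keys F. Poly_Mapping.lookup F k * Poly_Mapping.lookup (g k) l) \<noteq> 0"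
    by (simp add: in_keys_iff lookup_linear_ext)
  then obtain k where "k \<in> Poly_Mapping.keys F"
    "Poly_Mapping.lookup F k * Poly_Mapping.lookup (g k) l \<noteq> 0"
    by (meson sum.not_neutral_contains_not_neutral)
  thus "l \<in> (\<Union>k\<in>Poly_Mapping.keys F. Poly_Mapping.keys (g k))"
    by (auto simp: in_keys_iff)
qed

lemma linear_ext_cong:
  "(\<And>k. k \<in> Poly_Mapping.keys F \<Longrightarrow> g k = h k) \<Longrightarrow> linear_ext g F = linear_ext h F"
  by (simp add: linear_ext_def)

lemma linear_ext_of_basis_vec [simp]: "linear_ext basis_vec F = F"
proof (rule poly_mapping_eqI)
  fix l
  have "Poly_Mapping.lookup F k * Poly_Mapping.lookup (basis_vec k) l =
      (if k = l then Poly_Mapping.lookup F k else 0)" for k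
    by (simp add: basis_vec_def lookup_single when_def)
  thus "Poly_Mapping.lookup (linear_ext basis_vec F) l = Poly_Mapping.lookup F l"
    by (simp add: lookup_linear_ext in_keys_iff)
qed

lemma linear_ext_zero_fun [simp]: "linear_ext (\<lambda>_. 0) F = 0"
  by (rule poly_mapping_eqI) (simp add: lookup_linear_ext)

lemma keys_basis_vec [simp]: "Poly_Mapping.keys (basis_vec k) = {k}"
  by (simp add: basis_vec_def)

text \<open>On the free vector space, linearity means being the linear extension of some map on the basis;
  this form makes extensionality on basis vectors immediate.\<close>

definition linear_op :: "(('k \<Rightarrow>\<^sub>0 complex) \<Rightarrow> ('l \<Rightarrow>\<^sub>0 complex)) \<Rightarrow> bool" where
  "linear_op f \<longleftrightarrow> (\<exists>g. f = linear_ext g)"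

lemma linear_op_linear_ext [intro, simp]: "linear_op (linear_ext g)"
  by (auto simp: linear_op_def)

lemma linear_op_eq: "linear_op f \<Longrightarrow> f = linear_ext (\<lambda>k. f (basis_vec k))"
  by (auto simp: linear_op_def)

lemma linear_op_comp: "linear_op f \<Longrightarrow> linear_op g \<Longrightarrow> linear_op (\<lambda>F. f (g F))"
  by (auto simp: linear_op_def linear_ext_comp fun_eq_iff)

lemma linear_op_id [intro, simp]: "linear_op (\<lambda>F. F)"
  unfolding linear_op_def by (rule exI[of _ basis_vec]) auto

lemma linear_op_add:
  assumes "linear_op f" "linear_op g"
  shows "linear_op (\<lambda>F. f F + g F)"
proof -
  obtain a b where ab: "f = linear_ext a" "g = linear_ext b"
    using assms by (auto simp: linear_op_def)
  have "(\<lambda>F. f F + g F) = linear_ext (\<lambda>k. a k + b k)"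
    by (auto simp: ab lookup_add lookup_linear_ext distrib_left sum.distrib fun_eq_iff
        intro!: poly_mapping_eqI)
  thus ?thesis by (simp add: linear_op_def) blast
qed

lemma linear_op_scale: "linear_op (Poly_Mapping.map (\<lambda>z. c * z) :: ('k \<Rightarrow>\<^sub>0 complex) \<Rightarrow> _)"
proof -
  have "Poly_Mapping.map (\<lambda>z. c * z) F =
      linear_ext (\<lambda>k. Poly_Mapping.map (\<lambda>z. c * z) (basis_vec k)) F" for F :: "'k \<Rightarrow>\<^sub>0 complex"
    by (rule poly_mapping_eqI, subst (1) linear_ext_of_basis_vec[symmetric])
      (simp add: lookup_linear_ext sum_distrib_left mult.left_commute
        del: linear_ext_of_basis_vec)
  thus ?thesis unfolding linear_op_def by blast
qed

lemma linear_op_apply_add: "linear_op f \<Longrightarrow> f (F + G) = f F + f G"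
  by (auto simp: linear_op_def linear_ext_add)

lemma linear_op_apply_scale:
  "linear_op f \<Longrightarrow> f (Poly_Mapping.map (\<lambda>z. c * z) F) = Poly_Mapping.map (\<lambda>z. c * z) (f F)"
  by (auto simp: linear_op_def linear_ext_scale)

lemma linear_op_apply_zero: "linear_op f \<Longrightarrow> f 0 = 0"
  by (auto simp: linear_op_def)

text \<open>The action of a block with index \<open>i\<close> on the single space \<open>X i\<close>, before it is lifted to the
  free product.\<close>

definition face_act :: "('a \<Rightarrow> 'v \<Rightarrow> 'v) \<Rightarrow> ('a \<Rightarrow> 'v \<Rightarrow> 'v) \<Rightarrow> 'a factor \<Rightarrow> 'v \<Rightarrow> 'v" where
  "face_act L R z = (case z of Lft a \<Rightarrow> L a | Rgt a \<Rightarrow> R a)"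

definition local_op :: "('a \<Rightarrow> 'v \<Rightarrow> 'v) \<Rightarrow> ('a \<Rightarrow> 'v \<Rightarrow> 'v) \<Rightarrow> 'a factor list \<Rightarrow> 'v \<Rightarrow> 'v" where
  "local_op L R l = foldr (\<circ>) (map (face_act L R) l) id"

lemma local_op_simps [simp]:
  "local_op L R [] = id"
  "local_op L R (Lft a # l) = L a \<circ> local_op L R l"
  "local_op L R (Rgt a # l) = R a \<circ> local_op L R l"
  by (auto simp: local_op_def face_act_def)

lemma is_operator_local_op:
  assumes "\<And>a. a \<in> Al i \<Longrightarrow> is_operator sv X (L a)" "\<And>a. a \<in> Ar i \<Longrightarrow> is_operator sv X (R a)"
    and "set l \<subseteq> faces Al Ar i"
  shows "is_operator sv X (local_op L R l)"
  using assms(3)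
proof (induction l)
  case Nil
  show ?case by (simp add: is_operator_def)
next
  case (Cons z l)
  then show ?case
    using assms(1,2) by (cases z) (auto simp: is_operator_def faces_def)
qed

context specified_family
begin

abbreviation coord :: "'i \<Rightarrow> 'v \<Rightarrow> 'v \<Rightarrow> complex" where
  "coord i \<equiv> representation (basis_X i)"

lemma in_span_X: "x \<in> X i \<longleftrightarrow> x \<in> span (basis_X i)"
  by (simp add: span_basis_X)

lemma basis_subset_X: "b \<in> basis_X i \<Longrightarrow> b \<in> X i"
  by (simp add: in_span_X span_base)

lemma \<xi>_in_X: "\<xi> i \<in> X i"
  by (simp add: basis_subset_X basis_X_def)

lemma coord_\<xi>_Xo: "x \<in> Xo i \<Longrightarrow> coord i x (\<xi> i) = 0"
  using representation_extend[OF independent_basis_X, of x "B i" i] representation_ne_zero[of "B i" x]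
    \<xi>_notin_B[of i] by (auto simp: basis_X_def span_B subset_insertI)

text \<open>So this coordinate depends on \<open>Xo i\<close> and \<open>\<xi> i\<close> only, not on the Hamel basis, which makes it
  the state \<open>\<phi>\<close> in the regular representation below.\<close>

lemma coord_\<xi>: "y \<in> Xo i \<Longrightarrow> coord i (sv c (\<xi> i) + y) (\<xi> i) = c"
proof -
  assume y: "y \<in> Xo i"
  hence "y \<in> span (basis_X i)"
    using X_eq[of i] unfolding in_span_X[symmetric] by (auto intro: exI[of _ 0])
  moreover have "\<xi> i \<in> basis_X i" by (simp add: basis_X_def)
  ultimately show ?thesis
    using coord_\<xi>_Xo[OF y] independent_basis_X[of i]
    by (simp add: representation_add representation_scale span_scale span_base representation_basis)
qed

text \<open>\<open>tens i x w\<close> is \<open>x \<otimes> w\<close> for an arbitrary vector \<open>x\<close> of \<open>X i\<close>, and \<open>emb i x w\<close> is its image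
  under the isomorphism \<open>V i\<close>.  An operator on the free product is determined by its values on the
  vectors \<open>emb i x w\<close>, on which \<open>lam i T\<close> simply applies \<open>T\<close> to the first leg.\<close>

definition tens :: "'i \<Rightarrow> 'v \<Rightarrow> ('i \<times> 'v) list \<Rightarrow> ('v \<times> ('i \<times> 'v) list \<Rightarrow>\<^sub>0 complex)" where
  "tens i x w = (\<Sum>b | coord i x b \<noteq> 0. Poly_Mapping.single (b, w) (coord i x b))"

definition emb :: "'i \<Rightarrow> 'v \<Rightarrow> ('i \<times> 'v) list \<Rightarrow> (('i \<times> 'v) list \<Rightarrow>\<^sub>0 complex)" where
  "emb i x w = V i (tens i x w)"

lemma lookup_tens: "Poly_Mapping.lookup (tens i x w) (b, u) = (if u = w then coord i x b else 0)"
  by (simp add: tens_def lookup_sum lookup_single when_def finite_representation)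

lemma keys_tens: "Poly_Mapping.keys (tens i x w) \<subseteq> {b. coord i x b \<noteq> 0} \<times> {w}"
  by (auto simp: in_keys_iff lookup_tens split: if_splits)

lemma tens_basis: "b \<in> basis_X i \<Longrightarrow> tens i b w = basis_vec (b, w)"
  by (rule poly_mapping_eqI)
    (auto simp: lookup_tens basis_vec_def lookup_single when_def
      representation_basis[OF independent_basis_X] split: if_splits)

lemma tens_add:
  "x \<in> X i \<Longrightarrow> y \<in> X i \<Longrightarrow> tens i (x + y) w = tens i x w + tens i y w"
  by (rule poly_mapping_eqI)
    (auto simp: lookup_tens lookup_add in_span_X representation_add[OF independent_basis_X])

lemma tens_scale:
  "x \<in> X i \<Longrightarrow> tens i (sv c x) w = Poly_Mapping.map (\<lambda>z. c * z) (tens i x w)"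
  by (rule poly_mapping_eqI)
    (auto simp: lookup_tens in_span_X representation_scale[OF independent_basis_X])

lemma linear_op_V: "linear_op (V i)"
  by (simp add: V_def)

lemma linear_op_tensor_id: "linear_op (tensor_id i T)"
  by (simp add: tensor_id_def)

lemma linear_op_V_inv: "linear_op (V_inv i)"
  by (simp add: V_inv_def)

lemma linear_op_lam [intro, simp]: "linear_op (lam i T)"
  using linear_op_comp[OF linear_op_V linear_op_comp[OF linear_op_tensor_id linear_op_V_inv]]
  by (simp add: lam_def comp_def)

lemma linear_op_proj [intro, simp]: "linear_op (proj i)"
  by (simp add: proj_def)

lemma emb_add: "x \<in> X i \<Longrightarrow> y \<in> X i \<Longrightarrow> emb i (x + y) w = emb i x w + emb i y w"
  by (simp add: emb_def tens_add linear_op_apply_add[OF linear_op_V])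

lemma emb_scale: "x \<in> X i \<Longrightarrow> emb i (sv c x) w = Poly_Mapping.map (\<lambda>z. c * z) (emb i x w)"
  by (simp add: emb_def tens_scale linear_op_apply_scale[OF linear_op_V])

lemma emb_basis: "b \<in> basis_X i \<Longrightarrow> emb i b w = basis_vec (if b = \<xi> i then w else (i, b) # w)"
  by (simp add: emb_def tens_basis V_def)

lemma emb_\<xi>: "emb i (\<xi> i) w = basis_vec w"
  by (simp add: emb_basis basis_X_def)

lemma keys_emb:
  "Poly_Mapping.keys (emb i x w) \<subseteq>
     {u. \<exists>b\<in>basis_X i. coord i x b \<noteq> 0 \<and> u = (if b = \<xi> i then w else (i, b) # w)}"
proof
  fix u assume "u \<in> Poly_Mapping.keys (emb i x w)"
  hence "u \<in> (\<Union>k\<in>Poly_Mapping.keys (tens i x w). Poly_Mapping.keys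
      (case k of (b, w) \<Rightarrow> basis_vec (if b = \<xi> i then w else (i, b) # w)))"
    unfolding emb_def V_def by (rule subsetD[OF keys_linear_ext])
  then obtain k where k: "k \<in> Poly_Mapping.keys (tens i x w)"
    "u \<in> Poly_Mapping.keys (case k of (b, w) \<Rightarrow> basis_vec (if b = \<xi> i then w else (i, b) # w))"
    by (rule UN_E)
  obtain b where b: "k = (b, w)" "coord i x b \<noteq> 0" using subsetD[OF keys_tens k(1)] by auto
  moreover have "b \<in> basis_X i" using b(2) representation_ne_zero by blast
  ultimately show "u \<in> {u. \<exists>b\<in>basis_X i. coord i x b \<noteq> 0 \<and> u = (if b = \<xi> i then w else (i, b) # w)}"
    using k(2) by auto
qed

lemma words_left_subset: "w \<in> words_left i \<Longrightarrow> w \<in> words"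
  by (simp add: words_left_def)

lemma Cons_in_words: "w \<in> words_left i \<Longrightarrow> b \<in> B i \<Longrightarrow> (i, b) # w \<in> words"
  by (auto simp: words_left_def words_def distinct_adj_Cons hd_map)

lemma emb_in_free_product: "w \<in> words_left i \<Longrightarrow> emb i x w \<in> free_product"
  using keys_emb[of i x w]
  by (auto simp: free_product_def free_space_def basis_X_def words_left_subset Cons_in_words
      split: if_splits)

lemma words_cases:
  assumes "w \<in> words"
  obtains b u where "b \<in> basis_X i" "u \<in> words_left i" "basis_vec w = emb i b u"
proof (cases "w \<noteq> [] \<and> fst (hd w) = i")
  case True
  then obtain b u where w: "w = (i, b) # u" by (cases w) auto
  hence "b \<in> B i" "u \<in> words_left i"
    using assms by (auto simp: words_def words_left_def distinct_adj_Cons hd_map)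
  moreover have "b \<noteq> \<xi> i" using \<open>b \<in> B i\<close> \<xi>_notin_B by blast
  ultimately show ?thesis using that[of b u] by (simp add: emb_basis basis_X_def w)
next
  case False
  hence "w \<in> words_left i" using assms by (auto simp: words_left_def)
  thus ?thesis using that[of "\<xi> i" w] by (simp add: emb_\<xi> basis_X_def)
qed

text \<open>Every basis word is some \<open>emb i x w\<close>, for each fixed \<open>i\<close>.  This makes the identities for
  \<open>lam i\<close> and \<open>proj i\<close> below one-line checks on pure tensors.\<close>

lemma linear_op_eqI:
  assumes "linear_op f" "linear_op g" "F \<in> free_product"
    and "\<And>x w. x \<in> X i \<Longrightarrow> w \<in> words_left i \<Longrightarrow> f (emb i x w) = g (emb i x w)"
  shows "f F = g F"
proof -
  have "linear_ext (\<lambda>k. f (basis_vec k)) F = linear_ext (\<lambda>k. g (basis_vec k)) F"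
  proof (rule linear_ext_cong)
    fix w assume "w \<in> Poly_Mapping.keys F"
    hence "w \<in> words" using assms(3) by (auto simp: free_product_def free_space_def)
    then obtain b u where "b \<in> basis_X i" "u \<in> words_left i" "basis_vec w = emb i b u"
      by (rule words_cases)
    thus "f (basis_vec w) = g (basis_vec w)" using assms(4) basis_subset_X by simp
  qed
  thus ?thesis using linear_op_eq[OF assms(1)] linear_op_eq[OF assms(2)] by metis
qed

text \<open>\<open>T\<close> is linear on the subspace \<open>X i\<close> only, so the sum is kept inside \<open>X i\<close> along the way.\<close>

lemma operator_sum:
  assumes "is_operator sv (X i) T" "\<And>b. b \<in> S \<Longrightarrow> b \<in> X i"
  shows "T (\<Sum>b\<in>S. sv (c b) b) = (\<Sum>b\<in>S. sv (c b) (T b)) \<and> (\<Sum>b\<in>S. sv (c b) b) \<in> X i"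
proof -
  have "T (sv 0 0) = sv 0 (T 0)" "0 \<in> X i"
    using assms(1) subspace_0[OF subspace_X[of i]] unfolding is_operator_def by blast+
  hence "T 0 = 0" by simp
  with assms show ?thesis
    by (induction S rule: infinite_finite_induct)
      (auto simp: is_operator_def subspace_0 subspace_add subspace_scale subspace_X)
qed

text \<open>\<open>tensor_id\<close> is defined on basis vectors of \<open>X i\<close>; expanding \<open>x\<close> in the basis and using the
  linearity of \<open>T\<close> gives \<open>T x \<otimes> w\<close> for every \<open>x\<close>.\<close>

lemma tensor_id_tens:
  assumes T: "is_operator sv (X i) T" and x: "x \<in> X i"
  shows "tensor_id i T (tens i x w) = tens i (T x) w"
proof (rule poly_mapping_eqI)
  fix p :: "'v \<times> ('i \<times> 'v) list"
  obtain b' u where p: "p = (b', u)" by (cases p)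
  define S where "S = {b. coord i x b \<noteq> 0}"
  have S: "finite S" "\<And>b. b \<in> S \<Longrightarrow> b \<in> X i"
    using finite_representation representation_ne_zero basis_subset_X by (auto simp: S_def)
  have "x = (\<Sum>b\<in>S. sv (coord i x b) b)"
    unfolding S_def
    by (rule sum_nonzero_representation_eq[OF independent_basis_X, symmetric]) (use x in \<open>simp add: in_span_X\<close>)
  hence "T x = (\<Sum>b\<in>S. sv (coord i x b) (T b))" using operator_sum[OF T S(2)] by metis
  moreover have "T b \<in> span (basis_X i)" if "b \<in> S" for b
    using T S(2)[OF that] by (simp add: is_operator_def in_span_X[symmetric])
  ultimately have Tx: "coord i (T x) b' = (\<Sum>b\<in>S. coord i x b * coord i (T b) b')"
    by (simp add: representation_sum representation_scale independent_basis_X span_scale)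
  have tens: "tensor_id i T = linear_ext (\<lambda>(b, w). tens i (T b) w)"
    by (simp add: tensor_id_def tens_def)
  have prod_w: "S \<times> {w} = (\<lambda>b. (b, w)) ` S" by auto
  have "Poly_Mapping.keys (tens i x w) \<subseteq> S \<times> {w}" using keys_tens by (simp add: S_def)
  hence "Poly_Mapping.lookup (tensor_id i T (tens i x w)) p =
      (\<Sum>k\<in>S \<times> {w}. Poly_Mapping.lookup (tens i x w) k *
         Poly_Mapping.lookup (case k of (b, w) \<Rightarrow> tens i (T b) w) p)"
    unfolding tens using S(1) by (intro lookup_linear_ext_superset) auto
  also have "(\<Sum>k\<in>S \<times> {w}. Poly_Mapping.lookup (tens i x w) k *
         Poly_Mapping.lookup (case k of (b, w) \<Rightarrow> tens i (T b) w) p) =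
       (\<Sum>b\<in>S. Poly_Mapping.lookup (tens i x w) (b, w) *
         Poly_Mapping.lookup (tens i (T b) w) p)"
    unfolding prod_w by (simp add: sum.reindex inj_on_def)
  also have "\<dots> = Poly_Mapping.lookup (tens i (T x) w) p"
    by (simp add: lookup_tens p Tx)
  finally show "Poly_Mapping.lookup (tensor_id i T (tens i x w)) p =
      Poly_Mapping.lookup (tens i (T x) w) p" .
qed

lemma lam_emb:
  assumes "is_operator sv (X i) T" "x \<in> X i" "w \<in> words_left i"
  shows "lam i T (emb i x w) = emb i (T x) w"
proof -
  have "tens i x w \<in> tensor_left i"
    using keys_tens[of i x w] representation_ne_zero assms(3)
    by (force simp: tensor_left_def free_space_def)
  thus ?thesis
    by (simp add: lam_def emb_def V_inv_V tensor_id_tens assms)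
qed

text \<open>In the tensor decomposition, \<open>proj i\<close> acts on the second leg alone: it is the projection onto
  \<open>X i \<otimes> \<xi>\<close>.  This is why it commutes with every \<open>lam i T\<close>.\<close>

lemma proj_emb: "w \<in> words_left i \<Longrightarrow> proj i (emb i x w) = (if w = [] then emb i x w else 0)"
proof -
  assume w: "w \<in> words_left i"
  have "proj i (emb i x w) = linear_ext (if w = [] then basis_vec else (\<lambda>_. 0)) (emb i x w)"
    unfolding proj_def
  proof (rule linear_ext_cong)
    fix u assume "u \<in> Poly_Mapping.keys (emb i x w)"
    hence "u = w \<or> (\<exists>b. u = (i, b) # w)" using keys_emb by (fastforce split: if_splits)
    thus "(if u = [] \<or> (\<exists>b. u = [(i, b)]) then basis_vec u else 0) =
        (if w = [] then basis_vec else (\<lambda>_. 0)) u"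
      using w by (auto simp: words_left_def)
  qed
  thus ?thesis by (simp split: if_splits)
qed

lemma free_product_linear_op:
  assumes "linear_op f" "F \<in> free_product" "\<And>w. w \<in> words \<Longrightarrow> f (basis_vec w) \<in> free_product"
  shows "f F \<in> free_product"
proof -
  have "Poly_Mapping.keys (f F) \<subseteq> (\<Union>w\<in>Poly_Mapping.keys F. Poly_Mapping.keys (f (basis_vec w)))"
    using keys_linear_ext linear_op_eq[OF assms(1)] by metis
  thus ?thesis using assms(2,3) by (fastforce simp: free_product_def free_space_def)
qed

lemma lam_free_product:
  assumes "is_operator sv (X i) T" "F \<in> free_product"
  shows "lam i T F \<in> free_product"
proof (rule free_product_linear_op[OF linear_op_lam assms(2)])
  fix w assume "w \<in> words"
  then obtain b u where "b \<in> basis_X i" "u \<in> words_left i" "basis_vec w = emb i b u"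
    by (rule words_cases)
  thus "lam i T (basis_vec w) \<in> free_product"
    by (simp add: lam_emb assms basis_subset_X emb_in_free_product)
qed

lemma proj_free_product: "F \<in> free_product \<Longrightarrow> proj i F \<in> free_product"
  by (erule free_product_linear_op[OF linear_op_proj])
    (auto simp: proj_def free_product_def free_space_def)

lemma vacuum_free_product: "vacuum \<in> free_product"
  by (simp add: vacuum_def free_product_def free_space_def words_def)

lemma proj_idem: "F \<in> free_product \<Longrightarrow> proj i (proj i F) = proj i F"
  by (rule linear_op_eqI[of "\<lambda>F. proj i (proj i F)" "proj i" F i])
    (auto simp: proj_emb linear_op_apply_zero linear_op_comp[OF linear_op_proj linear_op_proj])

lemma lam_id: "F \<in> free_product \<Longrightarrow> lam i id F = F"
  using linear_op_eqI[of "lam i id" "\<lambda>F. F" F i]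
  by (auto simp: lam_emb is_operator_def)

lemma lam_comp:
  assumes "is_operator sv (X i) S" "is_operator sv (X i) T" "F \<in> free_product"
  shows "lam i (S \<circ> T) F = lam i S (lam i T F)"
proof -
  have "is_operator sv (X i) (S \<circ> T)" "\<And>x. x \<in> X i \<Longrightarrow> T x \<in> X i"
    using assms by (auto simp: is_operator_def)
  thus ?thesis
    using linear_op_eqI[of "lam i (S \<circ> T)" "\<lambda>F. lam i S (lam i T F)" F i] assms
    by (auto simp: lam_emb linear_op_comp[OF linear_op_lam linear_op_lam])
qed

lemma proj_lam_commute:
  assumes "is_operator sv (X i) T" "F \<in> free_product"
  shows "proj i (lam i T F) = lam i T (proj i F)"
  using assms
  by (intro linear_op_eqI[of "\<lambda>F. proj i (lam i T F)" "\<lambda>F. lam i T (proj i F)" F i])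
    (auto simp: lam_emb proj_emb linear_op_apply_zero linear_op_comp[OF linear_op_proj linear_op_lam]
      linear_op_comp[OF linear_op_lam linear_op_proj])

text \<open>The counterpart of \<open>a = (a - c \<cdot> 1) + c \<cdot> 1\<close> for the lifted operators.\<close>

lemma lam_add_scalar:
  assumes "is_operator sv (X i) S" "is_operator sv (X i) T" "F \<in> free_product"
    and "\<And>x. x \<in> X i \<Longrightarrow> T x = S x + sv c x"
  shows "lam i T F = lam i S F + Poly_Mapping.map (\<lambda>z. c * z) F"
proof (rule linear_op_eqI[where f = "lam i T" and g = "\<lambda>F. lam i S F + Poly_Mapping.map (\<lambda>z. c * z) F"])
  fix x w assume "x \<in> X i" "w \<in> words_left i"
  moreover from this have "S x \<in> X i" using assms by (auto simp: is_operator_def)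
  ultimately show "lam i T (emb i x w) = lam i S (emb i x w) + Poly_Mapping.map (\<lambda>z. c * z) (emb i x w)"
    using assms subspace_scale[OF subspace_X] by (simp add: lam_emb emb_add emb_scale)
qed (auto intro: linear_op_add linear_op_scale assms)

end


section \<open>Moments on the reduced free product satisfy the conditions\<close>

context specified_family
begin

definition faces_operators ::
  "('i \<Rightarrow> 'a set) \<Rightarrow> ('i \<Rightarrow> 'a set) \<Rightarrow> ('i \<Rightarrow> 'a \<Rightarrow> 'v \<Rightarrow> 'v) \<Rightarrow> ('i \<Rightarrow> 'a \<Rightarrow> 'v \<Rightarrow> 'v) \<Rightarrow> bool" where
  "faces_operators Al Ar L R \<longleftrightarrow>
     (\<forall>i. (\<forall>a\<in>Al i. is_operator sv (X i) (L i a)) \<and> (\<forall>a\<in>Ar i. is_operator sv (X i) (R i a)))"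

definition word_op :: "('i \<Rightarrow> 'a \<Rightarrow> 'v \<Rightarrow> 'v) \<Rightarrow> ('i \<Rightarrow> 'a \<Rightarrow> 'v \<Rightarrow> 'v) \<Rightarrow> ('i \<times> 'a factor) list
     \<Rightarrow> (('i \<times> 'v) list \<Rightarrow>\<^sub>0 complex) \<Rightarrow> (('i \<times> 'v) list \<Rightarrow>\<^sub>0 complex)" where
  "word_op L R zs = foldr (\<circ>) (map (factor_op L R) zs) id"

lemma word_op_simps [simp]:
  "word_op L R [] F = F"
  "word_op L R (z # zs) F = factor_op L R z (word_op L R zs F)"
  by (auto simp: word_op_def)

lemma word_op_append [simp]: "word_op L R (us @ vs) F = word_op L R us (word_op L R vs F)"
  by (induction us) auto

lemma linear_op_factor_op: "linear_op (factor_op L R z)"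
  by (cases "(L, R, z)" rule: factor_op.cases)
    (simp_all add: comp_def linear_op_comp[OF linear_op_proj linear_op_comp[OF linear_op_lam linear_op_proj]])

lemma linear_op_word_op: "linear_op (word_op L R zs)"
proof (induction zs)
  case Nil
  have "word_op L R [] = (\<lambda>F. F)" by auto
  thus ?case by simp
next
  case (Cons z zs)
  have "word_op L R (z # zs) = (\<lambda>F. factor_op L R z (word_op L R zs F))" by auto
  with linear_op_comp[OF linear_op_factor_op Cons.IH] show ?case by simp
qed

lemma local_op_operator:
  "faces_operators Al Ar L R \<Longrightarrow> set l \<subseteq> faces Al Ar i \<Longrightarrow>
     is_operator sv (X i) (local_op (L i) (R i) l)"
  by (rule is_operator_local_op[where Al = Al and Ar = Ar and i = i]) (auto simp: faces_operators_def)

text \<open>The projection commutes with \<open>lam i T\<close>, so the projections around the right factors of a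
  block can be collected into one.\<close>

lemma word_op_block:
  assumes "faces_operators Al Ar L R" "set l \<subseteq> faces Al Ar i" "F \<in> free_product"
  shows "word_op L R (map (Pair i) l) F =
    (if boolean_product l then proj i (lam i (local_op (L i) (R i) l) F)
     else lam i (local_op (L i) (R i) l) F)"
  using assms(2)
proof (induction l)
  case Nil
  show ?case using assms(3) by (simp add: lam_id)
next
  case (Cons z l)
  let ?T = "local_op (L i) (R i) l"
  have T: "is_operator sv (X i) ?T"
    using local_op_operator assms(1) Cons.prems by auto
  have F: "lam i ?T F \<in> free_product" using T assms(3) by (rule lam_free_product)
  show ?case
  proof (cases z)
    case (Lft a)
    have "is_operator sv (X i) (L i a)"
      using assms(1) Cons.prems by (auto simp: Lft faces_operators_def faces_def)
    moreover from this have "lam i (local_op (L i) (R i) (z # l)) F = lam i (L i a) (lam i ?T F)"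
      using T assms(3) by (simp add: Lft lam_comp)
    ultimately show ?thesis
      using Cons T F assms(3)
      by (simp add: Lft proj_lam_commute del: local_op_simps)
  next
    case (Rgt a)
    have "is_operator sv (X i) (R i a)"
      using assms(1) Cons.prems by (auto simp: Rgt faces_operators_def faces_def)
    moreover from this have "lam i (local_op (L i) (R i) (z # l)) F = lam i (R i a) (lam i ?T F)"
      using T assms(3) by (simp add: Rgt lam_comp)
    ultimately show ?thesis
      using Cons T F assms(3)
      by (simp add: Rgt proj_lam_commute proj_idem proj_free_product lam_free_product del: local_op_simps)
  qed
qed

lemma word_op_free_product:
  assumes "faces_operators Al Ar L R" "valid_word Al Ar zs" "F \<in> free_product"
  shows "word_op L R zs F \<in> free_product"
  using assms(2)
proof (induction zs)
  case Nil
  show ?case using assms(3) by simp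
next
  case (Cons iz zs)
  obtain i z where [simp]: "iz = (i, z)" by (cases iz)
  have "word_op L R (map (Pair i) [z]) (word_op L R zs F) \<in> free_product"
    using Cons local_op_operator[OF assms(1), of "[z]" i]
    by (subst word_op_block[OF assms(1)]) (auto intro: lam_free_product proj_free_product)
  thus ?case by simp
qed

lemma vacuum_emb: "vacuum = emb i (\<xi> i) []"
  by (simp add: vacuum_def emb_\<xi>)

lemma Nil_in_words_left: "[] \<in> words_left i"
  by (simp add: words_left_def words_def)

lemma lam_vacuum: "is_operator sv (X i) T \<Longrightarrow> lam i T vacuum = emb i (T (\<xi> i)) []"
  by (simp add: vacuum_emb[of i] lam_emb \<xi>_in_X Nil_in_words_left)

lemma lookup_emb_Nil: "Poly_Mapping.lookup (emb i x []) [] = coord i x (\<xi> i)"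
proof -
  have "Poly_Mapping.keys (tens i x []) \<subseteq> insert (\<xi> i, []) (Poly_Mapping.keys (tens i x []))"
    by auto
  hence "Poly_Mapping.lookup (emb i x []) [] =
      (\<Sum>k\<in>insert (\<xi> i, []) (Poly_Mapping.keys (tens i x [])). Poly_Mapping.lookup (tens i x []) k *
         Poly_Mapping.lookup (case k of (b, w) \<Rightarrow> basis_vec (if b = \<xi> i then w else (i, b) # w)) [])"
    unfolding emb_def V_def by (intro lookup_linear_ext_superset) auto
  also have "\<dots> = (\<Sum>k\<in>{(\<xi> i, [])}. Poly_Mapping.lookup (tens i x []) k *
         Poly_Mapping.lookup (case k of (b, w) \<Rightarrow> basis_vec (if b = \<xi> i then w else (i, b) # w)) [])"
    by (intro sum.mono_neutral_right) (auto simp: basis_vec_def lookup_single when_def lookup_tens split: if_splits)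
  also have "\<dots> = coord i x (\<xi> i)"
    by (simp add: lookup_tens basis_vec_def)
  finally show ?thesis .
qed

lemma lookup_proj_Nil: "Poly_Mapping.lookup (proj i F) [] = Poly_Mapping.lookup F []"
proof -
  have "Poly_Mapping.lookup (proj i F) [] =
      Poly_Mapping.lookup (linear_ext basis_vec F) []"
    unfolding proj_def lookup_linear_ext
    by (intro sum.cong refl) (auto simp: basis_vec_def lookup_single when_def)
  thus ?thesis by simp
qed

lemma keys_proj: "w \<in> Poly_Mapping.keys (proj i F) \<Longrightarrow> w = [] \<or> fst (hd w) = i"
  unfolding proj_def using subsetD[OF keys_linear_ext] by (fastforce split: if_splits)

text \<open>Besides the vacuum, \<open>proj i\<close> keeps only the words of length 1 with index \<open>i\<close>.  If they do not
  occur, only the vacuum component is left.\<close>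

lemma proj_no_letter:
  assumes "\<And>b. [(i, b)] \<notin> Poly_Mapping.keys F"
  shows "proj i F = Poly_Mapping.map (\<lambda>z. Poly_Mapping.lookup F [] * z) vacuum"
proof -
  have "proj i F = linear_ext (\<lambda>w. if w = [] then vacuum else 0) F"
    unfolding proj_def by (intro linear_ext_cong) (use assms in \<open>auto simp: vacuum_def\<close>)
  also have "\<dots> = Poly_Mapping.map (\<lambda>z. Poly_Mapping.lookup F [] * z) vacuum"
  proof (rule poly_mapping_eqI)
    fix u
    have "Poly_Mapping.lookup F w * Poly_Mapping.lookup (if w = [] then vacuum else 0) u =
        (if w = [] then Poly_Mapping.lookup F [] * Poly_Mapping.lookup vacuum u else 0)" for w
      by simp
    thus "Poly_Mapping.lookup (linear_ext (\<lambda>w. if w = [] then vacuum else 0) F) u =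
        Poly_Mapping.lookup (Poly_Mapping.map (\<lambda>z. Poly_Mapping.lookup F [] * z) vacuum) u"
      by (simp add: lookup_linear_ext in_keys_iff)
  qed
  finally show ?thesis .
qed

text \<open>Neither the lift nor the projection changes the vacuum moment of a single block, which is
  therefore a moment in \<open>X i\<close>.\<close>

lemma op_moment_block:
  assumes "faces_operators Al Ar L R" "set l \<subseteq> faces Al Ar i"
  shows "\<phi>\<^sub>\<xi> (word_op L R (map (Pair i) l)) = coord i (local_op (L i) (R i) l (\<xi> i)) (\<xi> i)"
  by (simp add: \<phi>\<^sub>\<xi>_def word_op_block[OF assms vacuum_free_product] lookup_proj_Nil
      lam_vacuum[OF local_op_operator[OF assms]] lookup_emb_Nil)

lemma keys_boolean_block:
  assumes "faces_operators Al Ar L R" "set l \<subseteq> faces Al Ar i" "boolean_product l"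
    and "F \<in> free_product" "w \<in> Poly_Mapping.keys (word_op L R (map (Pair i) l) F)"
  shows "w = [] \<or> fst (hd w) = i"
  using assms keys_proj by (simp add: word_op_block)

text \<open>A Boolean block first projects: from the vector produced by the blocks to its right it only
  sees the component along the vacuum and the words of length 1 with its own index.\<close>

lemma boolean_block_apply:
  assumes "faces_operators Al Ar L R" "set l \<subseteq> faces Al Ar i" "boolean_product l"
    and "F \<in> free_product" "\<And>b. [(i, b)] \<notin> Poly_Mapping.keys F"
  shows "word_op L R (map (Pair i) l) F =
    Poly_Mapping.map (\<lambda>z. Poly_Mapping.lookup F [] * z) (word_op L R (map (Pair i) l) vacuum)"
proof -
  let ?T = "local_op (L i) (R i) l"
  have T: "is_operator sv (X i) ?T" by (rule local_op_operator[OF assms(1,2)])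
  have "word_op L R (map (Pair i) l) F = proj i (lam i ?T (proj i F))"
    using assms T by (simp add: word_op_block proj_lam_commute proj_idem proj_free_product)
  thus ?thesis
    using assms(3) unfolding proj_no_letter[OF assms(5)]
    by (simp add: linear_op_apply_scale word_op_block[OF assms(1,2) vacuum_free_product])
qed

text \<open>The next block to the right has a different index, so each Boolean block sees only the vacuum
  component of what the blocks to its right produce, and starts afresh from it.\<close>

lemma op_moment_boolean_blocks:
  assumes "faces_operators Al Ar L R" "alternating_blocks Al Ar bs"
    and "\<forall>b\<in>set bs. boolean_product (snd b)"
  shows "\<phi>\<^sub>\<xi> (word_op L R (flatten_blocks bs)) = (\<Prod>b\<leftarrow>bs. \<phi>\<^sub>\<xi> (word_op L R (flatten_blocks [b])))"
  using assms(2,3)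
proof (induction bs)
  case Nil
  show ?case by (simp add: \<phi>\<^sub>\<xi>_def vacuum_def basis_vec_def)
next
  case (Cons b bs)
  obtain i l where b: "b = (i, l)" by (cases b)
  let ?G = "word_op L R (flatten_blocks bs) vacuum"
  have bs: "alternating_blocks Al Ar bs" "set l \<subseteq> faces Al Ar i" "boolean_product l"
    "bs = [] \<or> i \<noteq> fst (hd bs)"
    using Cons.prems by (auto simp: b alternating_blocks_Cons)
  have G: "?G \<in> free_product"
    using word_op_free_product assms(1) valid_word_flatten[OF bs(1)] vacuum_free_product by blast
  have "[(i, c)] \<notin> Poly_Mapping.keys ?G" for c
  proof (cases bs)
    case Nil
    thus ?thesis by (simp add: vacuum_def)
  next
    case (Cons b' bs')
    obtain i' l' where b': "b' = (i', l')" by (cases b')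
    have "alternating_blocks Al Ar bs'" "set l' \<subseteq> faces Al Ar i'" "boolean_product l'" "i \<noteq> i'"
      using bs(1,4) Cons.prems(2) by (auto simp: Cons b' alternating_blocks_Cons)
    moreover have "word_op L R (flatten_blocks bs') vacuum \<in> free_product"
      using word_op_free_product assms(1) valid_word_flatten calculation(1) vacuum_free_product by blast
    ultimately show ?thesis
      using keys_boolean_block[OF assms(1), of l' i' _ "[(i, c)]"] by (auto simp: Cons b')
  qed
  from boolean_block_apply[OF assms(1) bs(2,3) G this] Cons.IH[OF bs(1)] Cons.prems(2)
  show ?case by (simp add: \<phi>\<^sub>\<xi>_def b)
qed

text \<open>On a word that does not start with \<open>i\<close>, a centered left block with index \<open>i\<close> creates a new
  first letter with index \<open>i\<close>.\<close>

lemma keys_centered_lam: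
  assumes T: "is_operator sv (X i) T" "coord i (T (\<xi> i)) (\<xi> i) = 0"
    and F: "Poly_Mapping.keys F \<subseteq> words_left i" and w: "w \<in> Poly_Mapping.keys (lam i T F)"
  shows "w \<noteq> [] \<and> fst (hd w) = i"
proof -
  have "w \<in> (\<Union>u\<in>Poly_Mapping.keys F. Poly_Mapping.keys (lam i T (basis_vec u)))"
    using w subsetD[OF keys_linear_ext] linear_op_eq[OF linear_op_lam] by metis
  then obtain u where "u \<in> Poly_Mapping.keys F" "w \<in> Poly_Mapping.keys (lam i T (basis_vec u))"
    by (rule UN_E)
  hence "w \<in> Poly_Mapping.keys (emb i (T (\<xi> i)) u)"
    using F T(1) by (auto simp: emb_\<xi>[of i, symmetric] lam_emb \<xi>_in_X)
  thus ?thesis using keys_emb[of i "T (\<xi> i)" u] T(2) by (auto split: if_splits)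
qed

text \<open>The blocks to the right of the run produce words that are empty or start with the index of the
  Boolean block that follows the run, so the last block of the run meets no letter of its own index.
  From there on, each block of the run adds a letter in front.\<close>

lemma keys_centered_run:
  assumes "faces_operators Al Ar L R" "alternating_blocks Al Ar (rs @ vs)" "rs \<noteq> []"
    and "\<forall>b\<in>set rs. \<not> boolean_product (snd b) \<and> \<phi>\<^sub>\<xi> (word_op L R (flatten_blocks [b])) = 0"
    and "vs = [] \<or> boolean_product (snd (hd vs))"
    and "w \<in> Poly_Mapping.keys (word_op L R (flatten_blocks (rs @ vs)) vacuum)"
  shows "w \<noteq> [] \<and> fst (hd w) = fst (hd rs)"
  using assms(2-4,6)
proof (induction rs arbitrary: w)
  case Nil
  thus ?case by simp
next
  case (Cons b rs)
  obtain i l where b: "b = (i, l)" by (cases b)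
  let ?G = "word_op L R (flatten_blocks (rs @ vs)) vacuum"
  let ?T = "local_op (L i) (R i) l"
  have l: "set l \<subseteq> faces Al Ar i" "alternating_blocks Al Ar (rs @ vs)" "\<not> boolean_product l"
    "rs @ vs = [] \<or> i \<noteq> fst (hd (rs @ vs))"
    using Cons.prems by (auto simp: b alternating_blocks_Cons)
  have G: "?G \<in> free_product"
    using word_op_free_product assms(1) valid_word_flatten[OF l(2)] vacuum_free_product by blast
  have "u = [] \<or> fst (hd u) \<noteq> i" if u: "u \<in> Poly_Mapping.keys ?G" for u
  proof (cases "rs = []")
    case False
    have "u \<noteq> [] \<and> fst (hd u) = fst (hd rs)"
      using Cons.prems(3) False l(2) u by (intro Cons.IH) auto
    thus ?thesis using l(4) False by auto
  next
    case True
    show ?thesis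
    proof (cases vs)
      case Nil
      thus ?thesis using u True by (simp add: vacuum_def)
    next
      case (Cons c vs')
      obtain i' l' where c: "c = (i', l')" by (cases c)
      have "alternating_blocks Al Ar vs'" "set l' \<subseteq> faces Al Ar i'" "boolean_product l'" "i \<noteq> i'"
        using l(2,4) True assms(5) by (auto simp: Cons c alternating_blocks_Cons)
      moreover have "word_op L R (flatten_blocks vs') vacuum \<in> free_product"
        using word_op_free_product assms(1) valid_word_flatten calculation(1) vacuum_free_product
        by blast
      ultimately show ?thesis
        using keys_boolean_block[OF assms(1), of l' i' _ u] u True by (auto simp: Cons c)
    qed
  qed
  hence "Poly_Mapping.keys ?G \<subseteq> words_left i"
    using G by (auto simp: free_product_def free_space_def words_left_def)
  moreover have "coord i (?T (\<xi> i)) (\<xi> i) = 0"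
    using Cons.prems(3) op_moment_block[OF assms(1) l(1)] by (simp add: b)
  moreover have "w \<in> Poly_Mapping.keys (lam i ?T ?G)"
    using Cons.prems(4) word_op_block[OF assms(1) l(1) G] l(3) by (simp add: b)
  ultimately show ?case
    using keys_centered_lam local_op_operator[OF assms(1) l(1)] by (simp add: b)
qed

text \<open>After a centered run there is no vacuum component.  If the run comes first, the moment is zero;
  otherwise the Boolean block to the left of it, having another index, annihilates the vector.\<close>

lemma op_moment_block_conditions:
  assumes "faces_operators Al Ar L R"
  shows "block_conditions Al Ar (\<lambda>zs. \<phi>\<^sub>\<xi> (word_op L R zs))"
proof -
  have "\<phi>\<^sub>\<xi> (word_op L R (flatten_blocks (us @ rs @ vs))) = 0"
    if alt: "alternating_blocks Al Ar (us @ rs @ vs)" and rs: "rs \<noteq> []"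
      "\<forall>b\<in>set rs. \<not> boolean_product (snd b) \<and> \<phi>\<^sub>\<xi> (word_op L R (flatten_blocks [b])) = 0"
      and us: "us = [] \<or> boolean_product (snd (last us))"
      and vs: "vs = [] \<or> boolean_product (snd (hd vs))" for us rs vs
  proof -
    let ?G = "word_op L R (flatten_blocks (rs @ vs)) vacuum"
    have alt': "alternating_blocks Al Ar (rs @ vs)"
      using alt by (simp add: alternating_blocks_append[of _ _ us])
    have keys: "w \<noteq> [] \<and> fst (hd w) = fst (hd rs)" if "w \<in> Poly_Mapping.keys ?G" for w
      using keys_centered_run[OF assms alt' rs vs that] .
    hence "[] \<notin> Poly_Mapping.keys ?G" by blast
    hence Nil: "Poly_Mapping.lookup ?G [] = 0" by (simp add: in_keys_iff)
    have G: "?G \<in> free_product"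
      using word_op_free_product assms valid_word_flatten[OF alt'] vacuum_free_product by blast
    show ?thesis
    proof (cases us rule: rev_cases)
      case Nil
      thus ?thesis using \<open>Poly_Mapping.lookup ?G [] = 0\<close> by (simp add: \<phi>\<^sub>\<xi>_def)
    next
      case (snoc us' b)
      obtain i l where b: "b = (i, l)" by (cases b)
      have l: "boolean_product l" "set l \<subseteq> faces Al Ar i" "i \<noteq> fst (hd rs)"
        using alt us rs(1) by (auto simp: snoc b alternating_blocks_append alternating_blocks_Cons)
      hence "[(i, c)] \<notin> Poly_Mapping.keys ?G" for c using keys by fastforce
      hence "word_op L R (map (Pair i) l) ?G = Poly_Mapping.map (\<lambda>z. Poly_Mapping.lookup ?G [] * z)
          (word_op L R (map (Pair i) l) vacuum)"
        by (rule boolean_block_apply[OF assms l(2,1) G])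
      also have "\<dots> = 0"
        by (rule poly_mapping_eqI, subst lookup_map_mult) (use Nil in simp)
      finally have "word_op L R (map (Pair i) l) ?G = 0" .
      thus ?thesis
        by (simp add: snoc b \<phi>\<^sub>\<xi>_def linear_op_apply_zero[OF linear_op_word_op])
    qed
  qed
  thus ?thesis
    using op_moment_boolean_blocks[OF assms] unfolding block_conditions_def by blast
qed

lemma op_moment_admits_centering:
  assumes ops: "\<And>i a. is_operator sv (X i) (L i a)" "\<And>i a. is_operator sv (X i) (R i a)"
    and L: "\<And>i as c x. x \<in> X i \<Longrightarrow>
      local_op (L i) (R i) (map Lft as) x = L i (prod_list as - scale c 1) x + sv c x"
  shows "admits_centering scale (\<lambda>zs. \<phi>\<^sub>\<xi> (word_op L R zs))"
  unfolding admits_centering_def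
proof (intro allI)
  fix i as c us vs
  \<comment> \<open>Every element acts, so all words are words in the faces \<open>UNIV\<close>.\<close>
  have fo: "faces_operators (\<lambda>_. UNIV) (\<lambda>_. UNIV) L R"
    using ops by (simp add: faces_operators_def)
  have valid: "z \<in> faces (\<lambda>_. UNIV) (\<lambda>_. UNIV) k" for z k
    by (cases z) (auto simp: faces_def)
  have l: "set l \<subseteq> faces (\<lambda>_. UNIV) (\<lambda>_. UNIV) k" for l k
    by (rule subsetI) (rule valid)
  define G where "G = word_op L R vs vacuum"
  have G: "G \<in> free_product"
    unfolding G_def using valid
    by (intro word_op_free_product[OF fo] vacuum_free_product) (auto simp: valid_word_def)
  have "word_op L R (map (Pair i) (map Lft as)) G = lam i (local_op (L i) (R i) (map Lft as)) G"
    using word_op_block[OF fo l G, of i "map Lft as"] by (simp del: map_map)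
  also have "\<dots> = lam i (L i (prod_list as - scale c 1)) G + Poly_Mapping.map (\<lambda>z. c * z) G"
    using local_op_operator[OF fo l, of i "map Lft as"] ops G L by (intro lam_add_scalar)
  finally show "\<phi>\<^sub>\<xi> (word_op L R (us @ map (Pair i) (map Lft as) @ vs)) =
      \<phi>\<^sub>\<xi> (word_op L R (us @ [(i, Lft (prod_list as - scale c 1))] @ vs)) +
      c * \<phi>\<^sub>\<xi> (word_op L R (us @ vs))"
    by (simp add: \<phi>\<^sub>\<xi>_def G_def[symmetric] lookup_add linear_op_apply_add[OF linear_op_word_op]
        linear_op_apply_scale[OF linear_op_word_op] del: map_map)
qed

end


section \<open>Moments with respect to the state\<close>

lemma factor_product_simps [simp]:
  "factor_product [] = 1"
  "factor_product (z # zs) = elem z * factor_product zs"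
  "factor_product (us @ vs) = factor_product us * factor_product vs"
  by (auto simp: factor_product_def)

lemma block_conditions_cong:
  assumes "\<And>zs. valid_word Al Ar zs \<Longrightarrow> M zs = N zs"
  shows "block_conditions Al Ar M \<longleftrightarrow> block_conditions Al Ar N"
proof -
  \<comment> \<open>One implication suffices, by symmetry in the two functionals.\<close>
  have imp: "block_conditions Al Ar N"
    if eq: "\<And>zs. valid_word Al Ar zs \<Longrightarrow> M zs = N zs" and M: "block_conditions Al Ar M" for M N
  proof -
    have single: "M (flatten_blocks [b]) = N (flatten_blocks [b])"
      if "alternating_blocks Al Ar bs" "b \<in> set bs" for b bs
      using that by (intro eq) (auto simp: alternating_blocks_def)
    have whole: "M (flatten_blocks bs) = N (flatten_blocks bs)" if "alternating_blocks Al Ar bs" for bs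
      using that by (intro eq valid_word_flatten)
    show ?thesis
      unfolding block_conditions_def
    proof (intro conjI allI impI; elim conjE)
      fix bs assume bs: "alternating_blocks Al Ar bs" "\<forall>b\<in>set bs. boolean_product (snd b)"
      have "N (flatten_blocks bs) = (\<Prod>b\<leftarrow>bs. M (flatten_blocks [b]))"
        using M bs whole[OF bs(1)] unfolding block_conditions_def by metis
      also have "\<dots> = (\<Prod>b\<leftarrow>bs. N (flatten_blocks [b]))"
        using single[OF bs(1)] by (intro arg_cong[of _ _ prod_list] map_cong refl)
      finally show "N (flatten_blocks bs) = (\<Prod>b\<leftarrow>bs. N (flatten_blocks [b]))" .
    next
      fix us rs vs
      assume alt: "alternating_blocks Al Ar (us @ rs @ vs)" and rs: "rs \<noteq> []"
        "\<forall>b\<in>set rs. \<not> boolean_product (snd b) \<and> N (flatten_blocks [b]) = 0"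
        and "us = [] \<or> boolean_product (snd (last us))" "vs = [] \<or> boolean_product (snd (hd vs))"
      moreover have "\<forall>b\<in>set rs. \<not> boolean_product (snd b) \<and> M (flatten_blocks [b]) = 0"
        using rs(2) single[OF alt] by auto
      ultimately have "M (flatten_blocks (us @ rs @ vs)) = 0"
        using M unfolding block_conditions_def by blast
      thus "N (flatten_blocks (us @ rs @ vs)) = 0" using whole[OF alt] by simp
    qed
  qed
  show ?thesis using imp[of M N] imp[of N M] assms by metis
qed

definition indexed_blocks :: "nat \<Rightarrow> (nat \<Rightarrow> 'i) \<Rightarrow> (nat \<Rightarrow> 'f list) \<Rightarrow> ('i \<times> 'f list) list" where
  "indexed_blocks m j Z = map (\<lambda>k. (j k, Z k)) [1..<Suc m]"

lemma indexed_blocks_nth: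
  "indexed_blocks (length bs) (\<lambda>k. fst (bs ! (k - 1))) (\<lambda>k. snd (bs ! (k - 1))) = bs"
  by (rule nth_equalityI) (auto simp: indexed_blocks_def simp del: upt_Suc)

lemma alternating_indexed_blocks:
  "alternating_blocks Al Ar (indexed_blocks m j Z) \<longleftrightarrow> alternating_products Al Ar m j Z"
proof -
  have "distinct_adj (map fst (indexed_blocks m j Z)) \<longleftrightarrow> (\<forall>k. Suc k < m \<longrightarrow> j (Suc k) \<noteq> j (Suc (Suc k)))"
    by (auto simp: indexed_blocks_def distinct_adj_conv_nth simp del: upt_Suc)
  also have "\<dots> \<longleftrightarrow> (\<forall>k\<in>{2..m}. j (k - 1) \<noteq> j k)"
  proof
    assume *: "\<forall>k. Suc k < m \<longrightarrow> j (Suc k) \<noteq> j (Suc (Suc k))"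
    show "\<forall>k\<in>{2..m}. j (k - 1) \<noteq> j k"
    proof
      fix k assume "k \<in> {2..m}"
      moreover from this obtain n where "k = Suc (Suc n)" by (cases k; cases "k - 1") auto
      ultimately show "j (k - 1) \<noteq> j k" using * by simp
    qed
  next
    assume *: "\<forall>k\<in>{2..m}. j (k - 1) \<noteq> j k"
    show "\<forall>k. Suc k < m \<longrightarrow> j (Suc k) \<noteq> j (Suc (Suc k))"
    proof (intro allI impI)
      fix k assume "Suc k < m"
      thus "j (Suc k) \<noteq> j (Suc (Suc k))" using *[rule_format, of "Suc (Suc k)"] by auto
    qed
  qed
  finally show ?thesis
    by (auto simp: alternating_blocks_def alternating_products_def indexed_blocks_def simp del: upt_Suc)
qed

lemma factor_product_flatten:
  "factor_product (map snd (flatten_blocks bs)) = (\<Prod>b\<leftarrow>bs. factor_product (snd b))"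
  by (induction bs) (auto simp: comp_def)

lemma total_product_indexed_blocks:
  "total_product m Z = factor_product (map snd (flatten_blocks (indexed_blocks m j Z)))"
  by (simp add: factor_product_flatten total_product_def indexed_blocks_def comp_def del: upt_Suc)

text \<open>Only bookkeeping: a run \<open>rs\<close> in \<open>us @ rs @ vs\<close> occupies the positions from
  \<open>length us + 1\<close> to \<open>length us + length rs\<close>.\<close>

lemma moment_conditions_iff_block_conditions:
  fixes \<phi> :: "'a::monoid_mult \<Rightarrow> complex"
  shows "moment_conditions \<phi> Al Ar \<longleftrightarrow> block_conditions Al Ar (\<lambda>zs. \<phi> (factor_product (map snd zs)))"
proof
  assume mc: "moment_conditions \<phi> Al Ar"
  show "block_conditions Al Ar (\<lambda>zs. \<phi> (factor_product (map snd zs)))"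
    unfolding block_conditions_def
  proof (intro conjI allI impI; elim conjE)
    fix bs assume bs: "alternating_blocks Al Ar bs" "\<forall>b\<in>set bs. boolean_product (snd b)"
    define m j Z where "m = length bs" "j = (\<lambda>k. fst (bs ! (k - 1)))" "Z = (\<lambda>k. snd (bs ! (k - 1)))"
    have ib: "indexed_blocks m j Z = bs" unfolding m_j_Z_def by (rule indexed_blocks_nth)
    hence "boolean_condition \<phi> m Z"
      using mc bs(1) alternating_indexed_blocks unfolding moment_conditions_def by metis
    moreover have "\<forall>k\<in>{1..m}. boolean_product (Z k)" using bs(2) by (auto simp: m_j_Z_def)
    ultimately have "\<phi> (total_product m Z) = (\<Prod>k=1..m. \<phi> (factor_product (Z k)))"
      by (simp add: boolean_condition_def)
    also have "\<dots> = (\<Prod>k\<leftarrow>[1..<Suc m]. \<phi> (factor_product (Z k)))"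
      by (simp add: prod.distinct_set_conv_list[symmetric] atLeastLessThanSuc_atLeastAtMost del: upt_Suc)
    also have "\<dots> = (\<Prod>b\<leftarrow>indexed_blocks m j Z. \<phi> (factor_product (snd b)))"
      by (simp add: indexed_blocks_def comp_def del: upt_Suc)
    finally show "\<phi> (factor_product (map snd (flatten_blocks bs))) =
        (\<Prod>b\<leftarrow>bs. \<phi> (factor_product (map snd (flatten_blocks [b]))))"
      by (simp add: total_product_indexed_blocks[of m Z j] ib factor_product_flatten)
  next
    fix us rs vs
    assume alt: "alternating_blocks Al Ar (us @ rs @ vs)" and rs: "rs \<noteq> []"
      "\<forall>b\<in>set rs. \<not> boolean_product (snd b) \<and> \<phi> (factor_product (map snd (flatten_blocks [b]))) = 0"
      and us: "us = [] \<or> boolean_product (snd (last us))"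
      and vs: "vs = [] \<or> boolean_product (snd (hd vs))"
    define bs where "bs = us @ rs @ vs"
    define m j Z where "m = length bs" "j = (\<lambda>k. fst (bs ! (k - 1)))" "Z = (\<lambda>k. snd (bs ! (k - 1)))"
    define l\<^sub>1 l\<^sub>2 where "l\<^sub>1 = Suc (length us)" "l\<^sub>2 = length us + length rs"
    have ib: "indexed_blocks m j Z = bs" unfolding m_j_Z_def by (rule indexed_blocks_nth)
    hence "free_condition \<phi> m Z"
      using mc alt alternating_indexed_blocks unfolding moment_conditions_def bs_def by metis
    moreover have run: "\<exists>b\<in>set rs. Z k = snd b" if "k \<in> {l\<^sub>1..l\<^sub>2}" for k
    proof -
      have "bs ! (k - 1) = rs ! (k - 1 - length us)" "k - 1 - length us < length rs"
        using that by (auto simp: bs_def l\<^sub>1_l\<^sub>2_def nth_append)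
      thus ?thesis using nth_mem by (force simp: m_j_Z_def)
    qed
    moreover have "1 \<le> l\<^sub>1" "l\<^sub>1 \<le> l\<^sub>2" "l\<^sub>2 \<le> m"
      using rs(1) by (auto simp: l\<^sub>1_l\<^sub>2_def m_j_Z_def bs_def Suc_le_eq)
    moreover have "boolean_product (Z (l\<^sub>1 - 1)) \<or> l\<^sub>1 = 1"
      using us by (auto simp: l\<^sub>1_l\<^sub>2_def m_j_Z_def bs_def nth_append last_conv_nth)
    moreover have "boolean_product (Z (l\<^sub>2 + 1)) \<or> l\<^sub>2 = m"
      using vs by (auto simp: l\<^sub>1_l\<^sub>2_def m_j_Z_def bs_def nth_append hd_conv_nth)
    moreover have "\<forall>k\<in>{l\<^sub>1..l\<^sub>2}. \<not> boolean_product (Z k) \<and> \<phi> (factor_product (Z k)) = 0"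
      using run rs(2) by (fastforce simp: factor_product_flatten)
    ultimately have "\<phi> (total_product m Z) = 0"
      unfolding free_condition_def by blast
    thus "\<phi> (factor_product (map snd (flatten_blocks (us @ rs @ vs)))) = 0"
      by (simp add: total_product_indexed_blocks[of m Z j] ib bs_def)
  qed
next
  assume bc: "block_conditions Al Ar (\<lambda>zs. \<phi> (factor_product (map snd zs)))"
  show "moment_conditions \<phi> Al Ar"
    unfolding moment_conditions_def
  proof (intro allI impI conjI)
    fix m j Z assume "alternating_products Al Ar m j Z"
    hence alt: "alternating_blocks Al Ar (indexed_blocks m j Z)"
      by (simp add: alternating_indexed_blocks)
    show "boolean_condition \<phi> m Z"
      unfolding boolean_condition_def
    proof
      assume "\<forall>k\<in>{1..m}. boolean_product (Z k)"
      hence "\<forall>b\<in>set (indexed_blocks m j Z). boolean_product (snd b)"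
        by (auto simp: indexed_blocks_def simp del: upt_Suc)
      hence "\<phi> (total_product m Z) =
          (\<Prod>b\<leftarrow>indexed_blocks m j Z. \<phi> (factor_product (map snd (flatten_blocks [b]))))"
        using bc alt unfolding block_conditions_def total_product_indexed_blocks[of m Z j] by blast
      also have "\<dots> = (\<Prod>k\<leftarrow>[1..<Suc m]. \<phi> (factor_product (Z k)))"
        by (simp add: factor_product_flatten indexed_blocks_def comp_def del: upt_Suc)
      also have "\<dots> = (\<Prod>k=1..m. \<phi> (factor_product (Z k)))"
        by (simp add: prod.distinct_set_conv_list[symmetric] atLeastLessThanSuc_atLeastAtMost del: upt_Suc)
      finally show "\<phi> (total_product m Z) = (\<Prod>k=1..m. \<phi> (factor_product (Z k)))" .
    qed
    show "free_condition \<phi> m Z"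
      unfolding free_condition_def
    proof (intro impI, elim exE conjE)
      fix l\<^sub>1 l\<^sub>2
      assume l: "1 \<le> l\<^sub>1" "l\<^sub>1 \<le> l\<^sub>2" "l\<^sub>2 \<le> m" and run: "\<forall>k\<in>{l\<^sub>1..l\<^sub>2}. \<not> boolean_product (Z k)"
        "\<forall>k\<in>{l\<^sub>1..l\<^sub>2}. \<phi> (factor_product (Z k)) = 0"
        and left: "boolean_product (Z (l\<^sub>1 - 1)) \<or> l\<^sub>1 = 1"
        and right: "boolean_product (Z (l\<^sub>2 + 1)) \<or> l\<^sub>2 = m"
      let ?f = "\<lambda>k. (j k, Z k)"
      define us rs vs where "us = map ?f [1..<l\<^sub>1]" "rs = map ?f [l\<^sub>1..<Suc l\<^sub>2]"
        "vs = map ?f [Suc l\<^sub>2..<Suc m]"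
      have "[1..<Suc m] = [1..<l\<^sub>1] @ [l\<^sub>1..<Suc l\<^sub>2] @ [Suc l\<^sub>2..<Suc m]"
        using l upt_add_eq_append[of 1 l\<^sub>1 "Suc m - l\<^sub>1"]
          upt_add_eq_append[of l\<^sub>1 "Suc l\<^sub>2" "Suc m - Suc l\<^sub>2"]
        by (simp del: upt_Suc)
      hence parts: "indexed_blocks m j Z = us @ rs @ vs"
        by (simp add: indexed_blocks_def us_rs_vs_def del: upt_Suc)
      have "alternating_blocks Al Ar (us @ rs @ vs)" using alt by (simp add: parts)
      moreover have "rs \<noteq> []" using l by (simp add: us_rs_vs_def del: upt_Suc)
      moreover have "\<forall>b\<in>set rs. \<not> boolean_product (snd b) \<and>
          \<phi> (factor_product (map snd (flatten_blocks [b]))) = 0"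
        using run by (auto simp: us_rs_vs_def factor_product_flatten comp_def simp del: upt_Suc)
      moreover have "us = [] \<or> boolean_product (snd (last us))"
        using left l by (cases l\<^sub>1) (auto simp: us_rs_vs_def)
      moreover have "vs = [] \<or> boolean_product (snd (hd vs))"
        using right l by (cases "l\<^sub>2 = m") (auto simp: us_rs_vs_def upt_conv_Cons simp del: upt_Suc)
      ultimately have "\<phi> (factor_product (map snd (flatten_blocks (us @ rs @ vs)))) = 0"
        using bc unfolding block_conditions_def by blast
      thus "\<phi> (total_product m Z) = 0"
        by (simp only: total_product_indexed_blocks[of m Z j] parts)
    qed
  qed
qed

lemma local_op_mult [simp]: "local_op (*) (*) l x = factor_product l * x"
  by (induction l) (auto simp: local_op_def face_act_def mult.assoc split: factor.splits)

context nc_prob_space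
begin

lemma \<phi>_add: "\<phi> (x + y) = \<phi> x + \<phi> y"
  and \<phi>_scale: "\<phi> (scale c x) = c * \<phi> x"
proof -
  interpret linear_form: Vector_Spaces.linear scale "(*)" \<phi> by (rule linear_\<phi>)
  show "\<phi> (x + y) = \<phi> x + \<phi> y" "\<phi> (scale c x) = c * \<phi> x"
    by (rule linear_form.add linear_form.scale)+
qed

lemma \<phi>_zero [simp]: "\<phi> 0 = 0"
  using \<phi>_scale[of 0 0] by simp

lemma \<phi>_diff: "\<phi> (x - y) = \<phi> x - \<phi> y"
  using \<phi>_add[of "x - y" y] by simp

lemma is_operator_mult_left: "is_operator scale UNIV ((*) a)"
  by (simp add: is_operator_def distrib_left scale_mult_right)

lemma operator_hom_mult_left: "operator_hom scale scale S UNIV (*)"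
  by (simp add: operator_hom_def is_operator_mult_left distrib_right scale_mult_left mult.assoc)

lemma moment_admits_centering:
  "admits_centering scale (\<lambda>zs. \<phi> (factor_product (map snd zs)))"
proof -
  have "\<phi> (u * (a * v)) = \<phi> (u * ((a - scale c 1) * v)) + c * \<phi> (u * v)" for u a v c
    by (simp add: algebra_simps \<phi>_diff \<phi>_scale scale_mult_left scale_mult_right)
  moreover have "factor_product (map Lft as) = prod_list as" for as :: "'a list"
    by (induction as) auto
  ultimately show ?thesis
    by (simp add: admits_centering_def comp_def)
qed

text \<open>Regular representation: each \<open>X i\<close> may be the whole algebra, with the unit as specified vector
  and the kernel of \<open>\<phi>\<close> as complement, because the model only has to reproduce the moments of
  single pairs of faces; the conditions fix all the others.\<close>

lemma specified_family_regular:
  obtains B where "specified_family scale (\<lambda>_. UNIV) (\<lambda>_. {x. \<phi> x = 0}) (\<lambda>_. 1) (\<lambda>_. B)"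
proof -
  have sub: "subspace {x. \<phi> x = 0}"
    by (auto simp: subspace_def \<phi>_add \<phi>_scale)
  obtain B where B: "B \<subseteq> {x. \<phi> x = 0}" "independent B" "{x. \<phi> x = 0} \<subseteq> span B"
    by (rule maximal_independent_subset)
  have "span B = {x. \<phi> x = 0}"
    using B sub span_minimal by blast
  moreover have "x \<in> {scale c 1 + x |c x. x \<in> {x. \<phi> x = 0}}" for x
    by (auto intro!: exI[of _ "\<phi> x"] exI[of _ "x - scale (\<phi> x) 1"] simp: \<phi>_diff \<phi>_scale \<phi>_one)
  ultimately have "specified_family scale (\<lambda>_. UNIV) (\<lambda>_. {x. \<phi> x = 0}) (\<lambda>_. 1) (\<lambda>_. B)"
    using B(2) sub by unfold_locales (auto simp: \<phi>_one)
  thus ?thesis by (rule that)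
qed

end


section \<open>The characterization\<close>

lemma free_boolean_independent_imp_moment_conditions:
  assumes "free_boolean_independent sv scale \<phi> Al Ar"
  shows "moment_conditions \<phi> Al Ar"
proof -
  obtain X Xo \<xi> B L R where sf: "specified_family sv X Xo \<xi> B"
    and models: "specified_family.models sv X \<xi> B scale \<phi> Al Ar L R"
    using assms unfolding free_boolean_independent_def by blast
  interpret specified_family sv X Xo \<xi> B by (rule sf)
  have "faces_operators Al Ar L R"
    using models by (simp add: models_def faces_operators_def operator_hom_def)
  hence op: "block_conditions Al Ar (\<lambda>zs. \<phi>\<^sub>\<xi> (word_op L R zs))"
    by (rule op_moment_block_conditions)
  have eq: "\<phi> (factor_product (map snd zs)) = \<phi>\<^sub>\<xi> (word_op L R zs)" if "valid_word Al Ar zs" for zs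
    using models that by (simp add: models_def valid_word_def word_op_def)
  show ?thesis
    unfolding moment_conditions_iff_block_conditions
    by (rule iffD2[OF block_conditions_cong op]) (rule eq)
qed

text \<open>Both faces act by left multiplication.  The word of a block applied to the unit is its product,
  whose coordinate along the unit is its \<open>\<phi>\<close>-moment, so the two moment functionals agree on single
  blocks and the uniqueness applies.  The units in the left faces keep centered elements inside them.\<close>

lemma moment_conditions_imp_free_boolean_independent:
  fixes scale :: "complex \<Rightarrow> 'a::ring_1 \<Rightarrow> 'a" and Al Ar :: "'i \<Rightarrow> 'a set"
  assumes "nc_prob_space scale \<phi>" and Al: "\<And>i. nonunital_subalgebra scale (Al i)"
    and one: "\<And>i. 1 \<in> Al i" and mc: "moment_conditions \<phi> Al Ar"
  shows "free_boolean_independent scale scale \<phi> Al Ar"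
proof -
  interpret nc_prob_space scale \<phi> by fact
  obtain B where sf: "specified_family scale (\<lambda>_::'i. UNIV) (\<lambda>_. {x. \<phi> x = 0}) (\<lambda>_. 1) (\<lambda>_. B)"
    using specified_family_regular by blast
  interpret F: specified_family scale "\<lambda>_::'i. UNIV" "\<lambda>_. {x. \<phi> x = 0}" "\<lambda>_. 1" "\<lambda>_. B" by (rule sf)
  let ?L = "\<lambda>_::'i. (*) :: 'a \<Rightarrow> 'a \<Rightarrow> 'a"
  have ops: "F.faces_operators Al Ar ?L ?L"
    by (simp add: F.faces_operators_def is_operator_mult_left)
  have coord: "F.coord i x 1 = \<phi> x" for i x
    using F.coord_\<xi>[where y = "x - scale (\<phi> x) 1" and c = "\<phi> x" and i = i] by (simp add: \<phi>_diff \<phi>_scale \<phi>_one)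
  have left: "prod_list as - scale c 1 \<in> Al i" if "set as \<subseteq> Al i" for i as c
  proof -
    have "prod_list as \<in> Al i"
      using that Al[of i] one by (induction as) (auto simp: nonunital_subalgebra_def)
    thus ?thesis
      using Al[of i] one[of i] subspace_diff subspace_scale unfolding nonunital_subalgebra_def by blast
  qed
  have "\<phi> (factor_product (map snd zs)) = F.\<phi>\<^sub>\<xi> (F.word_op ?L ?L zs)" if "valid_word Al Ar zs" for zs
  proof (rule block_conditions_unique[OF _ moment_admits_centering _ _ _ _ left that])
    show "block_conditions Al Ar (\<lambda>zs. \<phi> (factor_product (map snd zs)))"
      using mc by (simp add: moment_conditions_iff_block_conditions)
    show "block_conditions Al Ar (\<lambda>zs. F.\<phi>\<^sub>\<xi> (F.word_op ?L ?L zs))"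
      by (rule F.op_moment_block_conditions[OF ops])
    have "factor_product (map Lft as) = prod_list as" for as :: "'a list"
      by (induction as) auto
    thus "admits_centering scale (\<lambda>zs. F.\<phi>\<^sub>\<xi> (F.word_op ?L ?L zs))"
      by (intro F.op_moment_admits_centering)
        (auto simp: is_operator_mult_left left_diff_distrib scale_mult_left)
    show "\<phi> (factor_product (map snd (map (Pair i) l))) = F.\<phi>\<^sub>\<xi> (F.word_op ?L ?L (map (Pair i) l))"
      if "set l \<subseteq> faces Al Ar i" for i l
      using F.op_moment_block[OF ops that] by (simp add: coord comp_def)
  qed (simp_all add: \<phi>_one)
  hence "F.models scale \<phi> Al Ar ?L ?L"
    unfolding F.models_def F.word_op_def valid_word_def by (simp add: operator_hom_mult_left)
  thus ?thesis
    unfolding free_boolean_independent_def using sf by blast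
qed

theorem theorem4p5:
  fixes scale :: "complex \<Rightarrow> 'a::ring_1 \<Rightarrow> 'a" and \<phi> :: "'a \<Rightarrow> complex"
    and Al Ar :: "'i \<Rightarrow> 'a set"
    and sv :: "complex \<Rightarrow> 'v::ab_group_add \<Rightarrow> 'v"
  assumes "nc_prob_space scale \<phi>"
    and "\<And>i. nonunital_subalgebra scale (Al i)" and "\<And>i. nonunital_subalgebra scale (Ar i)"
    and "vector_space sv"
  shows "(free_boolean_independent sv scale \<phi> Al Ar \<longrightarrow> moment_conditions \<phi> Al Ar) \<and>
    ((\<forall>i. 1 \<in> Al i) \<longrightarrow>
      (free_boolean_independent scale scale \<phi> Al Ar \<longleftrightarrow> moment_conditions \<phi> Al Ar))"
  using free_boolean_independent_imp_moment_conditions[of sv scale \<phi> Al Ar]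
    free_boolean_independent_imp_moment_conditions[of scale scale \<phi> Al Ar]
    moment_conditions_imp_free_boolean_independent[OF assms(1), of Al Ar] assms(2)
  by blast

end
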